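(* Let $k$ be a commutative ring with $1$, $q\in k$ an invertible element, and $n\ge 1$. Let $L=(sl_{n+1}^{+})_q$ be the free $k$-module with basis $\{e_{ij}\mid 1\le i<j\le n+1\}$, with the $k$-linear maps $S:L\otimes_kL\to L\otimes_kL$ and $[,]_q:L\otimes_kL\to L$ defined in the context. Then $L$, with bracket $[,]_q$ and with $\gamma=1-S:L\otimes_k L\to L\otimes_k L$, is a balanced generalised Lie algebra.
   Context: **Balanced generalised Lie algebra (Lyubashenko–Sudbery).** A $k$-module $L$ with $k$-linear maps $\beta:L\otimes_k L\to L$ (bracket) and $\gamma:L\otimes_k L\to L\otimes_k L$ such that: - generalised antisymmetry: if $t\in L\otimes_kL$ and $\gamma(t)=0$ then $\beta(t)=0$; - left Jacobi identity: $\beta(\beta\otimes 1)=\beta(1\otimes\beta)(\gamma\otimes 1)$ on $L^{\otimes 3}$; - right Jacobi identity: $\beta(1\otimes\beta)=\beta(\beta\otimes 1)(1\otimes\gamma)$ on $L^{\otimes 3}$. For $\gamma=1-S$ and $\beta=[,]$ the two Jacobi identities read $[,](1\otimes[,])-[,]([,]\otimes1)-[,](1\otimes[,])(S\otimes1)=0$ and $[,](1\otimes[,])-[,]([,]\otimes1)+[,]([,]\otimes1)(1\otimes S)=0$. **The module $(sl_{n+1}^{+})_q$.** Let $e_{ij}$ ($1\le i<j\le n+1$) denote the matrix units, which form the canonical basis $\mathcal{B}$ of the strictly upper triangular matrices in $sl_{n+1}$. Let $[,]$ be the usual matrix commutator, $h_{ij}=[e_{ij},e_{ij}^{t}]$,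 and let $c_{ab,ij}\in\mathbb{Z}$ be defined by $[h_{ab},e_{ij}]=c_{ab,ij}e_{ij}$. Order $\mathcal{B}$ totally by: $e_{ab}<e_{ij}$ if $a+b<i+j$, or ($a+b=i+j$ and $b<j$). Let $(sl_{n+1}^{+})_q$ be the free $k$-module on $\mathcal{B}$. Define $k$-linear maps as follows. - $S(e_{ab}\otimes e_{ij})=q^{c_{ab,ij}}e_{ij}\otimes e_{ab}$ if $e_{ab}<e_{ij}$; $S(e_{ab}\otimes e_{ab})=e_{ab}\otimes e_{ab}$; and $S^2=1$ (so $S(e_{ij}\otimes e_{ab})=q^{-c_{ab,ij}}e_{ab}\otimes e_{ij}$ if $e_{ab}<e_{ij}$). - $[e_{ab},e_{ij}]_q=[e_{ab},e_{ij}]$ (usual commutator) if $e_{ab}<e_{ij}$; $[,]_qS=-[,]_q$; and $[e_{ab},e_{ab}]_q=0$. *)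

theory Defs
  imports "HOL-Algebra.Module" "HOL-Algebra.AbelCoset" "Jordan_Normal_Form.Matrix"
begin

hide_const (open) Multiset.mult

section \<open>Linear maps, free modules and quotient modules\<close>

definition lin_maps ::
    "('r, 'm) ring_scheme \<Rightarrow> ('r, 'a, 'm1) module_scheme \<Rightarrow> ('r, 'b, 'm2) module_scheme \<Rightarrow> ('a \<Rightarrow> 'b) set"
  where "lin_maps R M N = {f \<in> carrier M \<rightarrow> carrier N.
    (\<forall>x\<in>carrier M. \<forall>y\<in>carrier M. f (x \<oplus>\<^bsub>M\<^esub> y) = f x \<oplus>\<^bsub>N\<^esub> f y) \<and>
    (\<forall>a\<in>carrier R. \<forall>x\<in>carrier M. f (a \<odot>\<^bsub>M\<^esub> x) = a \<odot>\<^bsub>N\<^esub> f x)}"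

text \<open>The ring multiplication and unit of a \<^type>\<open>module_ext\<close> record are irrelevant
  for modules and are left undefined.\<close>

definition free_module :: "('r, 'm) ring_scheme \<Rightarrow> 'x set \<Rightarrow> ('r, 'x \<Rightarrow> 'r) module"
  where "free_module R X =
    \<lparr>carrier = {f. (\<forall>x. f x \<in> carrier R) \<and> finite {x. f x \<noteq> \<zero>\<^bsub>R\<^esub>} \<and> {x. f x \<noteq> \<zero>\<^bsub>R\<^esub>} \<subseteq> X},
     mult = undefined, one = undefined,
     zero = (\<lambda>x. \<zero>\<^bsub>R\<^esub>), add = (\<lambda>f g x. f x \<oplus>\<^bsub>R\<^esub> g x),
     smult = (\<lambda>a f x. a \<otimes>\<^bsub>R\<^esub> f x)\<rparr>"

definition free_gen :: "('r, 'm) ring_scheme \<Rightarrow> 'x \<Rightarrow> 'x \<Rightarrow> 'r"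
  where "free_gen R x = (\<lambda>y. if y = x then \<one>\<^bsub>R\<^esub> else \<zero>\<^bsub>R\<^esub>)"

text \<open>\<open>lin_ext R P g\<close> is the linear map from a free module to \<open>P\<close> that sends the generator
  \<open>x\<close> to \<open>g x\<close>.\<close>

definition lin_ext ::
    "('r, 'm) ring_scheme \<Rightarrow> ('r, 'p, 'm1) module_scheme \<Rightarrow> ('x \<Rightarrow> 'p) \<Rightarrow> ('x \<Rightarrow> 'r) \<Rightarrow> 'p"
  where "lin_ext R P g f = (\<Oplus>\<^bsub>P\<^esub>x\<in>{x. f x \<noteq> \<zero>\<^bsub>R\<^esub>}. f x \<odot>\<^bsub>P\<^esub> g x)"

definition quot_module ::
    "('r, 'm) ring_scheme \<Rightarrow> ('r, 'a, 'm1) module_scheme \<Rightarrow> 'a set \<Rightarrow> ('r, 'a set) module"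
  where "quot_module R M N =
    \<lparr>carrier = a_rcosets\<^bsub>M\<^esub> N, mult = undefined, one = undefined,
     zero = N, add = set_add M,
     smult = (\<lambda>a A. \<Union>x\<in>A. N +>\<^bsub>M\<^esub> (a \<odot>\<^bsub>M\<^esub> x))\<rparr>"


section \<open>Tensor products\<close>

definition tensor_rels ::
    "('r, 'm) ring_scheme \<Rightarrow> ('r, 'a, 'm1) module_scheme \<Rightarrow> ('r, 'b, 'm2) module_scheme
      \<Rightarrow> ('a \<times> 'b \<Rightarrow> 'r) set"
  where "tensor_rels R M N = (let F = free_module R (carrier M \<times> carrier N); e = free_gen R in
      {e (x \<oplus>\<^bsub>M\<^esub> x', y) \<ominus>\<^bsub>F\<^esub> (e (x, y) \<oplus>\<^bsub>F\<^esub> e (x', y)) | x x' y.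
         x \<in> carrier M \<and> x' \<in> carrier M \<and> y \<in> carrier N}
    \<union> {e (x, y \<oplus>\<^bsub>N\<^esub> y') \<ominus>\<^bsub>F\<^esub> (e (x, y) \<oplus>\<^bsub>F\<^esub> e (x, y')) | x y y'.
         x \<in> carrier M \<and> y \<in> carrier N \<and> y' \<in> carrier N}
    \<union> {e (a \<odot>\<^bsub>M\<^esub> x, y) \<ominus>\<^bsub>F\<^esub> a \<odot>\<^bsub>F\<^esub> e (x, y) | a x y.
         a \<in> carrier R \<and> x \<in> carrier M \<and> y \<in> carrier N}
    \<union> {e (x, a \<odot>\<^bsub>N\<^esub> y) \<ominus>\<^bsub>F\<^esub> a \<odot>\<^bsub>F\<^esub> e (x, y) | a x y.
         a \<in> carrier R \<and> x \<in> carrier M \<and> y \<in> carrier N})"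

definition tensor_sub ::
    "('r, 'm) ring_scheme \<Rightarrow> ('r, 'a, 'm1) module_scheme \<Rightarrow> ('r, 'b, 'm2) module_scheme
      \<Rightarrow> ('a \<times> 'b \<Rightarrow> 'r) set"
  where "tensor_sub R M N =
    \<Inter>{H. submodule H R (free_module R (carrier M \<times> carrier N)) \<and> tensor_rels R M N \<subseteq> H}"

definition tensor ::
    "('r, 'm) ring_scheme \<Rightarrow> ('r, 'a, 'm1) module_scheme \<Rightarrow> ('r, 'b, 'm2) module_scheme
      \<Rightarrow> ('r, ('a \<times> 'b \<Rightarrow> 'r) set) module"
  where "tensor R M N =
    quot_module R (free_module R (carrier M \<times> carrier N)) (tensor_sub R M N)"

definition tensor_elem ::
    "('r, 'm) ring_scheme \<Rightarrow> ('r, 'a, 'm1) module_scheme \<Rightarrow> ('r, 'b, 'm2) module_scheme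
      \<Rightarrow> 'a \<Rightarrow> 'b \<Rightarrow> ('a \<times> 'b \<Rightarrow> 'r) set"
  where "tensor_elem R M N x y =
    tensor_sub R M N +>\<^bsub>free_module R (carrier M \<times> carrier N)\<^esub> free_gen R (x, y)"

text \<open>For bilinear \<open>h\<close>, \<open>tensor_lift R P h\<close> is the linear map from the tensor product to \<open>P\<close>
  with \<open>x \<otimes> y \<mapsto> h x y\<close>: its value at a coset is the common value of the linear extension of
  \<open>h\<close> at all representatives.\<close>

definition tensor_lift ::
    "('r, 'm) ring_scheme \<Rightarrow> ('r, 'p, 'm1) module_scheme \<Rightarrow> ('a \<Rightarrow> 'b \<Rightarrow> 'p)
      \<Rightarrow> ('a \<times> 'b \<Rightarrow> 'r) set \<Rightarrow> 'p"
  where "tensor_lift R P h t = the_elem (lin_ext R P (\<lambda>(x, y). h x y) ` t)"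

definition tensor_map ::
    "('r, 'm) ring_scheme \<Rightarrow> ('r, 'c, 'm1) module_scheme \<Rightarrow> ('r, 'd, 'm2) module_scheme
      \<Rightarrow> ('a \<Rightarrow> 'c) \<Rightarrow> ('b \<Rightarrow> 'd) \<Rightarrow> ('a \<times> 'b \<Rightarrow> 'r) set \<Rightarrow> ('c \<times> 'd \<Rightarrow> 'r) set"
  \<comment> \<open>\<open>M'\<close> and \<open>N'\<close> are the codomains of \<open>f\<close> and \<open>g\<close>\<close>
  where "tensor_map R M' N' f g =
    tensor_lift R (tensor R M' N') (\<lambda>x y. tensor_elem R M' N' (f x) (g y))"

text \<open>The canonical isomorphisms \<open>(L \<otimes> M) \<otimes> N \<rightarrow> L \<otimes> (M \<otimes> N)\<close> and back.\<close>

definition tensor_assoc ::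
    "('r, 'm) ring_scheme \<Rightarrow> ('r, 'a, 'm1) module_scheme \<Rightarrow> ('r, 'b, 'm2) module_scheme
      \<Rightarrow> ('r, 'c, 'm3) module_scheme
      \<Rightarrow> (('a \<times> 'b \<Rightarrow> 'r) set \<times> 'c \<Rightarrow> 'r) set \<Rightarrow> ('a \<times> ('b \<times> 'c \<Rightarrow> 'r) set \<Rightarrow> 'r) set"
  where "tensor_assoc R L M N = (let P = tensor R L (tensor R M N) in
    tensor_lift R P (\<lambda>t z. tensor_lift R P
      (\<lambda>x y. tensor_elem R L (tensor R M N) x (tensor_elem R M N y z)) t))"

definition tensor_assoc_inv ::
    "('r, 'm) ring_scheme \<Rightarrow> ('r, 'a, 'm1) module_scheme \<Rightarrow> ('r, 'b, 'm2) module_scheme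
      \<Rightarrow> ('r, 'c, 'm3) module_scheme
      \<Rightarrow> ('a \<times> ('b \<times> 'c \<Rightarrow> 'r) set \<Rightarrow> 'r) set \<Rightarrow> (('a \<times> 'b \<Rightarrow> 'r) set \<times> 'c \<Rightarrow> 'r) set"
  where "tensor_assoc_inv R L M N = (let P = tensor R (tensor R L M) N in
    tensor_lift R P (\<lambda>x t. tensor_lift R P
      (\<lambda>y z. tensor_elem R (tensor R L M) N (tensor_elem R L M x y) z) t))"


section \<open>Balanced generalised Lie algebras\<close>

text \<open>In the left Jacobi identity \<open>L\<^sup>\<otimes>\<^sup>3\<close> is \<open>(L \<otimes> L) \<otimes> L\<close>, in the right one
  \<open>L \<otimes> (L \<otimes> L)\<close>; the two are identified through the associativity isomorphism.\<close>

locale balanced_gen_lie_algebra = module R L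
  for R :: "('r, 'm) ring_scheme" and L :: "('r, 'a, 'm1) module_scheme" +
  fixes \<beta> :: "('a \<times> 'a \<Rightarrow> 'r) set \<Rightarrow> 'a"
    and \<gamma> :: "('a \<times> 'a \<Rightarrow> 'r) set \<Rightarrow> ('a \<times> 'a \<Rightarrow> 'r) set"
  assumes bracket_linear: "\<beta> \<in> lin_maps R (tensor R L L) L"
    and gamma_linear: "\<gamma> \<in> lin_maps R (tensor R L L) (tensor R L L)"
    and generalised_antisymmetry:
      "\<And>t. t \<in> carrier (tensor R L L) \<Longrightarrow> \<gamma> t = \<zero>\<^bsub>tensor R L L\<^esub> \<Longrightarrow> \<beta> t = \<zero>\<^bsub>L\<^esub>"
    and left_jacobi:
      "\<And>t. t \<in> carrier (tensor R (tensor R L L) L) \<Longrightarrow>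
         \<beta> (tensor_map R L L \<beta> (\<lambda>x. x) t) =
         \<beta> (tensor_map R L L (\<lambda>x. x) \<beta>
              (tensor_assoc R L L L (tensor_map R (tensor R L L) L \<gamma> (\<lambda>x. x) t)))"
    and right_jacobi:
      "\<And>t. t \<in> carrier (tensor R L (tensor R L L)) \<Longrightarrow>
         \<beta> (tensor_map R L L (\<lambda>x. x) \<beta> t) =
         \<beta> (tensor_map R L L \<beta> (\<lambda>x. x)
              (tensor_assoc_inv R L L L (tensor_map R L (tensor R L L) (\<lambda>x. x) \<gamma> t)))"


section \<open>The module \<open>(sl\<^sub>n\<^sub>+\<^sub>1\<^sup>+)\<^sub>q\<close>\<close>

text \<open>The matrix unit \<open>e\<^sub>i\<^sub>j\<close> is represented by the pair \<open>(i, j)\<close>, with \<open>i\<close> and \<open>j\<close> counted from 1,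
  whereas matrix entries are counted from 0.\<close>

definition sl_basis :: "nat \<Rightarrow> (nat \<times> nat) set"
  where "sl_basis n = {(i, j). 1 \<le> i \<and> i < j \<and> j \<le> n + 1}"

definition mat_unit :: "nat \<Rightarrow> nat \<times> nat \<Rightarrow> int mat"
  where "mat_unit n = (\<lambda>(i, j). mat (n + 1) (n + 1) (\<lambda>(r, s). if r + 1 = i \<and> s + 1 = j then 1 else 0))"

definition commutator :: "int mat \<Rightarrow> int mat \<Rightarrow> int mat"
  where "commutator A B = A * B - B * A"

definition h_mat :: "nat \<Rightarrow> nat \<times> nat \<Rightarrow> int mat"
  where "h_mat n x = commutator (mat_unit n x) (transpose_mat (mat_unit n x))"

definition c_coeff :: "nat \<Rightarrow> nat \<times> nat \<Rightarrow> nat \<times> nat \<Rightarrow> int"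
  where "c_coeff n x y = (THE c. commutator (h_mat n x) (mat_unit n y) = c \<cdot>\<^sub>m mat_unit n y)"

definition basis_less :: "nat \<times> nat \<Rightarrow> nat \<times> nat \<Rightarrow> bool"
  where "basis_less = (\<lambda>(a, b) (i, j). a + b < i + j \<or> (a + b = i + j \<and> b < j))"

definition slq :: "('r, 'm) ring_scheme \<Rightarrow> nat \<Rightarrow> ('r, nat \<times> nat \<Rightarrow> 'r) module"
  where "slq R n = free_module R (sl_basis n)"

text \<open>The coordinates in \<open>R\<close> of the usual commutator of two matrix units with respect to the
  basis of matrix units.\<close>

definition usual_bracket ::
    "('r, 'm) ring_scheme \<Rightarrow> nat \<Rightarrow> nat \<times> nat \<Rightarrow> nat \<times> nat \<Rightarrow> nat \<times> nat \<Rightarrow> 'r"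
  where "usual_bracket R n x y = (\<lambda>(i, j). if (i, j) \<in> sl_basis n
    then [commutator (mat_unit n x) (mat_unit n y) $$ (i - 1, j - 1)] \<cdot>\<^bsub>R\<^esub> \<one>\<^bsub>R\<^esub> else \<zero>\<^bsub>R\<^esub>)"

definition slq_bilin ::
    "('r, 'm) ring_scheme \<Rightarrow> ('r, 'p, 'm1) module_scheme \<Rightarrow> (nat \<times> nat \<Rightarrow> nat \<times> nat \<Rightarrow> 'p)
      \<Rightarrow> ((nat \<times> nat \<Rightarrow> 'r) \<times> (nat \<times> nat \<Rightarrow> 'r) \<Rightarrow> 'r) set \<Rightarrow> 'p"
  \<comment> \<open>the linear map on the tensor square with \<open>e\<^sub>x \<otimes> e\<^sub>y \<mapsto> g x y\<close>\<close>
  where "slq_bilin R P g = tensor_lift R P (\<lambda>u v. lin_ext R P (\<lambda>x. lin_ext R P (g x) v) u)"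

definition slq_S ::
    "('r, 'm) ring_scheme \<Rightarrow> 'r \<Rightarrow> nat
      \<Rightarrow> ((nat \<times> nat \<Rightarrow> 'r) \<times> (nat \<times> nat \<Rightarrow> 'r) \<Rightarrow> 'r) set
      \<Rightarrow> ((nat \<times> nat \<Rightarrow> 'r) \<times> (nat \<times> nat \<Rightarrow> 'r) \<Rightarrow> 'r) set"
  where "slq_S R q n = (let L = slq R n; T = tensor R L L in
    slq_bilin R T (\<lambda>x y.
      (if x = y then \<one>\<^bsub>R\<^esub>
       else if basis_less x y then q [^]\<^bsub>R\<^esub> c_coeff n x y
       else q [^]\<^bsub>R\<^esub> (- c_coeff n y x)) \<odot>\<^bsub>T\<^esub> tensor_elem R L L (free_gen R y) (free_gen R x)))"

text \<open>The last case below is forced by \<open>[,]\<^sub>q S = - [,]\<^sub>q\<close>: if \<open>e\<^sub>y < e\<^sub>x\<close>, then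
  \<open>S (e\<^sub>x \<otimes> e\<^sub>y) = q\<^sup>-\<^sup>c e\<^sub>y \<otimes> e\<^sub>x\<close> with \<open>c = c_coeff n y x\<close>.\<close>

definition slq_bracket ::
    "('r, 'm) ring_scheme \<Rightarrow> 'r \<Rightarrow> nat
      \<Rightarrow> ((nat \<times> nat \<Rightarrow> 'r) \<times> (nat \<times> nat \<Rightarrow> 'r) \<Rightarrow> 'r) set \<Rightarrow> (nat \<times> nat \<Rightarrow> 'r)"
  where "slq_bracket R q n = (let L = slq R n in
    slq_bilin R L (\<lambda>x y.
      if x = y then \<zero>\<^bsub>L\<^esub>
      else if basis_less x y then usual_bracket R n x y
      else \<ominus>\<^bsub>L\<^esub> (q [^]\<^bsub>R\<^esub> (- c_coeff n y x) \<odot>\<^bsub>L\<^esub> usual_bracket R n y x)))"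

end

theory Submission
  imports Defs
begin

text \<open>All maps involved are linear, so by the universal properties of free modules and tensor
  products the axioms only have to be checked on basis vectors. There the bracket is
  \<open>[e\<^sub>a\<^sub>b, e\<^sub>b\<^sub>j] = e\<^sub>a\<^sub>j\<close>, \<open>[e\<^sub>b\<^sub>j, e\<^sub>a\<^sub>b] = -q e\<^sub>a\<^sub>j\<close>, and zero otherwise. A nonzero term of a
  Jacobi identity needs two matching index pairs, which leaves six cases; in each of them the
  coefficient of \<open>S\<close> is \<open>q\<close>, \<open>q\<^sup>-\<^sup>1\<close> or \<open>1\<close>, or the term containing it vanishes. Antisymmetry is not
  checked on eigenvectors of \<open>S\<close>, where it would only give \<open>2 \<beta>(t) = 0\<close>: it follows from a
  factorisation of the bracket through \<open>1 - S\<close>.\<close>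

section \<open>Linear maps\<close>

text \<open>A tensor product is here a concrete quotient of a free module on pairs, and maps out of
  it are read off from cosets by \<open>the_elem\<close>. Well-definedness and linearity therefore
  have to be proved before any reduction to basis vectors. The order on the basis fits the bracket
  because a < b < j gives a + b < b + j: if a product of two matrix units is nonzero, its left
  factor is the smaller one. The weight coefficient of such a pair is always -1, and this is where
  the factor q comes from. The six cases are the six orders in which x, y, z can be the links e_ab,
  e_bc, e_cd of a chain. The two ends of a chain have four distinct indices, so their bracket is
  zero and S flips them with coefficient 1. In each Jacobi identity the term whose inner bracket
  joins the two ends thus vanishes, and only two terms have to be compared.\<close>

lemma lin_mapsI:
  assumes "\<And>x. x \<in> carrier M \<Longrightarrow> f x \<in> carrier N"
    and "\<And>x y. \<lbrakk>x \<in> carrier M; y \<in> carrier M\<rbrakk> \<Longrightarrow> f (x \<oplus>\<^bsub>M\<^esub> y) = f x \<oplus>\<^bsub>N\<^esub> f y"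
    and "\<And>a x. \<lbrakk>a \<in> carrier R; x \<in> carrier M\<rbrakk> \<Longrightarrow> f (a \<odot>\<^bsub>M\<^esub> x) = a \<odot>\<^bsub>N\<^esub> f x"
  shows "f \<in> lin_maps R M N"
  using assms unfolding lin_maps_def by auto

lemma lin_maps_closed: "\<lbrakk>f \<in> lin_maps R M N; x \<in> carrier M\<rbrakk> \<Longrightarrow> f x \<in> carrier N"
  and lin_maps_add: "\<lbrakk>f \<in> lin_maps R M N; x \<in> carrier M; y \<in> carrier M\<rbrakk>
    \<Longrightarrow> f (x \<oplus>\<^bsub>M\<^esub> y) = f x \<oplus>\<^bsub>N\<^esub> f y"
  and lin_maps_smult: "\<lbrakk>f \<in> lin_maps R M N; a \<in> carrier R; x \<in> carrier M\<rbrakk>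
    \<Longrightarrow> f (a \<odot>\<^bsub>M\<^esub> x) = a \<odot>\<^bsub>N\<^esub> f x"
  unfolding lin_maps_def by auto

lemma lin_maps_zero:
  assumes "module R M" "module R N" "f \<in> lin_maps R M N"
  shows "f \<zero>\<^bsub>M\<^esub> = \<zero>\<^bsub>N\<^esub>"
proof -
  interpret M: module R M by fact
  interpret N: module R N by fact
  have "f (\<zero>\<^bsub>R\<^esub> \<odot>\<^bsub>M\<^esub> \<zero>\<^bsub>M\<^esub>) = \<zero>\<^bsub>R\<^esub> \<odot>\<^bsub>N\<^esub> f \<zero>\<^bsub>M\<^esub>"
    by (intro lin_maps_smult[OF assms(3)]) auto
  thus ?thesis using lin_maps_closed[OF assms(3)] by simp
qed

lemma lin_maps_uminus:
  assumes "module R M" "module R N" "f \<in> lin_maps R M N" "x \<in> carrier M"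
  shows "f (\<ominus>\<^bsub>M\<^esub> x) = \<ominus>\<^bsub>N\<^esub> f x"
proof -
  interpret M: module R M by fact
  interpret N: module R N by fact
  have "f (\<ominus>\<^bsub>M\<^esub> x) \<oplus>\<^bsub>N\<^esub> f x = f (\<ominus>\<^bsub>M\<^esub> x \<oplus>\<^bsub>M\<^esub> x)"
    using lin_maps_add[OF assms(3)] assms(4) by simp
  also have "\<dots> = \<zero>\<^bsub>N\<^esub>"
    using lin_maps_zero[OF assms(1-3)] assms(4) by (simp add: M.M.l_neg)
  finally show ?thesis
    using lin_maps_closed[OF assms(3)] assms(4) by (simp add: N.M.minus_equality)
qed

lemma lin_maps_minus:
  assumes "module R M" "module R N" "f \<in> lin_maps R M N" "x \<in> carrier M" "y \<in> carrier M"
  shows "f (x \<ominus>\<^bsub>M\<^esub> y) = f x \<ominus>\<^bsub>N\<^esub> f y"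
proof -
  interpret M: module R M by fact
  show ?thesis
    using lin_maps_add[OF assms(3)] lin_maps_uminus[OF assms(1-3)] assms(4,5)
    unfolding a_minus_def by simp
qed

lemma lin_maps_id: "(\<lambda>x. x) \<in> lin_maps R M M"
  by (simp add: lin_maps_def)

lemma lin_maps_comp:
  "\<lbrakk>f \<in> lin_maps R M N; g \<in> lin_maps R N P\<rbrakk> \<Longrightarrow> (\<lambda>x. g (f x)) \<in> lin_maps R M P"
  by (auto simp: lin_maps_def Pi_def)

lemma lin_maps_add_map:
  assumes "module R N" "f \<in> lin_maps R M N" "g \<in> lin_maps R M N"
  shows "(\<lambda>x. f x \<oplus>\<^bsub>N\<^esub> g x) \<in> lin_maps R M N"
proof -
  interpret N: module R N by fact
  show ?thesis
    using assms(2,3)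
    by (intro lin_mapsI) (simp_all add: lin_maps_closed lin_maps_add lin_maps_smult
      N.smult_r_distr N.M.a_ac)
qed

lemma lin_maps_smult_map:
  assumes "module R N" "f \<in> lin_maps R M N" "a \<in> carrier R"
  shows "(\<lambda>x. a \<odot>\<^bsub>N\<^esub> f x) \<in> lin_maps R M N"
proof -
  interpret N: module R N by fact
  show ?thesis
    using assms(2,3)
    by (intro lin_mapsI) (simp_all add: lin_maps_closed lin_maps_add lin_maps_smult
      N.smult_r_distr N.smult_assoc1[symmetric] N.m_comm)
qed

lemma lin_maps_minus_map:
  assumes "module R M" "module R N" "f \<in> lin_maps R M N" "g \<in> lin_maps R M N"
  shows "(\<lambda>x. f x \<ominus>\<^bsub>N\<^esub> g x) \<in> lin_maps R M N"
proof -
  interpret M: module R M by fact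
  interpret N: module R N by fact
  \<comment> \<open>Subtraction is addition of the multiple by -1, which reduces the claim to
    closure under sums and scalar multiples.\<close>
  have "f x \<ominus>\<^bsub>N\<^esub> g x = f x \<oplus>\<^bsub>N\<^esub> (\<ominus>\<^bsub>R\<^esub> \<one>\<^bsub>R\<^esub>) \<odot>\<^bsub>N\<^esub> g x" if "x \<in> carrier M" for x
    using that lin_maps_closed[OF assms(4)] by (simp add: a_minus_def N.smult_l_minus)
  moreover have "(\<lambda>x. f x \<oplus>\<^bsub>N\<^esub> (\<ominus>\<^bsub>R\<^esub> \<one>\<^bsub>R\<^esub>) \<odot>\<^bsub>N\<^esub> g x) \<in> lin_maps R M N"
    by (intro lin_maps_add_map lin_maps_smult_map assms) auto
  ultimately show ?thesis by (simp add: lin_maps_def Pi_def)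
qed

section \<open>Free modules\<close>

lemma free_module_simps:
  "carrier (free_module R X) =
    {f. (\<forall>x. f x \<in> carrier R) \<and> finite {x. f x \<noteq> \<zero>\<^bsub>R\<^esub>} \<and> {x. f x \<noteq> \<zero>\<^bsub>R\<^esub>} \<subseteq> X}"
  "\<zero>\<^bsub>free_module R X\<^esub> = (\<lambda>x. \<zero>\<^bsub>R\<^esub>)"
  "f \<oplus>\<^bsub>free_module R X\<^esub> g = (\<lambda>x. f x \<oplus>\<^bsub>R\<^esub> g x)"
  "a \<odot>\<^bsub>free_module R X\<^esub> f = (\<lambda>x. a \<otimes>\<^bsub>R\<^esub> f x)"
  by (simp_all add: free_module_def)

lemma (in cring) free_module_closed_add:
  assumes "f \<in> carrier (free_module R X)" "g \<in> carrier (free_module R X)"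
  shows "(\<lambda>x. f x \<oplus> g x) \<in> carrier (free_module R X)"
proof -
  have "{x. f x \<oplus> g x \<noteq> \<zero>} \<subseteq> {x. f x \<noteq> \<zero>} \<union> {x. g x \<noteq> \<zero>}"
    by auto
  thus ?thesis using assms
    unfolding free_module_simps by (auto intro: finite_subset[where B="{x. f x \<noteq> \<zero>} \<union> {x. g x \<noteq> \<zero>}"])
qed

lemma (in cring) free_module_closed_smult:
  assumes "f \<in> carrier (free_module R X)" "a \<in> carrier R"
  shows "(\<lambda>x. a \<otimes> f x) \<in> carrier (free_module R X)"
proof -
  have "{x. a \<otimes> f x \<noteq> \<zero>} \<subseteq> {x. f x \<noteq> \<zero>}"
    using assms by auto
  thus ?thesis using assms unfolding free_module_simps by (auto intro: finite_subset)
qed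

lemma (in cring) free_module_module: "module R (free_module R X)"
proof (intro moduleI is_cring abelian_groupI)
  fix f assume f: "f \<in> carrier (free_module R X)"
  \<comment> \<open>The inverse is taken as the multiple by -1, so that its finite support comes
    from closure under scalars.\<close>
  show "\<exists>g\<in>carrier (free_module R X). g \<oplus>\<^bsub>free_module R X\<^esub> f = \<zero>\<^bsub>free_module R X\<^esub>"
    using free_module_closed_smult[OF f, of "\<ominus> \<one>"] f
    by (intro bexI[of _ "\<lambda>x. \<ominus> \<one> \<otimes> f x"]) (auto simp: free_module_simps fun_eq_iff l_minus l_neg)
next
  fix f g assume "f \<in> carrier (free_module R X)" "g \<in> carrier (free_module R X)"
  thus "f \<oplus>\<^bsub>free_module R X\<^esub> g \<in> carrier (free_module R X)"
    using free_module_closed_add by (simp add: free_module_simps(3))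
next
  fix a f assume "a \<in> carrier R" "f \<in> carrier (free_module R X)"
  thus "a \<odot>\<^bsub>free_module R X\<^esub> f \<in> carrier (free_module R X)"
    using free_module_closed_smult by (simp add: free_module_simps(4))
qed (auto simp: free_module_simps fun_eq_iff a_ac l_distr r_distr m_assoc)

lemma (in cring) free_gen_closed: "x \<in> X \<Longrightarrow> free_gen R x \<in> carrier (free_module R X)"
proof -
  assume "x \<in> X"
  moreover have "{y. free_gen R x y \<noteq> \<zero>} \<subseteq> {x}"
    by (auto simp: free_gen_def)
  ultimately show ?thesis
    by (auto simp: free_module_simps free_gen_def intro: finite_subset)
qed

text \<open>Since supports are finite, this is an induction on a finite set containing the support;
  each step clears one coordinate.\<close>

lemma (in cring) free_module_induct [consumes 1, case_names zero add]:
  assumes f: "f \<in> carrier (free_module R X)"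
    and zero: "P \<zero>\<^bsub>free_module R X\<^esub>"
    and add: "\<And>f a x. \<lbrakk>f \<in> carrier (free_module R X); P f; a \<in> carrier R; x \<in> X\<rbrakk>
      \<Longrightarrow> P (f \<oplus>\<^bsub>free_module R X\<^esub> a \<odot>\<^bsub>free_module R X\<^esub> free_gen R x)"
  shows "P f"
proof -
  have "P f" if "finite A" "f \<in> carrier (free_module R X)" "{x. f x \<noteq> \<zero>} \<subseteq> A" for A f
    using that
  proof (induction A arbitrary: f rule: finite_induct)
    case empty
    hence "f = \<zero>\<^bsub>free_module R X\<^esub>" by (auto simp: free_module_simps)
    thus ?case using zero by simp
  next
    case (insert x A)
    show ?case
    proof (cases "f x = \<zero>")
      case True
      thus ?thesis using insert by (intro insert.IH) auto
    next
      case False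
      hence x: "x \<in> X" using insert.prems by (auto simp: free_module_simps)
      define g where "g = f(x := \<zero>)"
      have "{y. g y \<noteq> \<zero>} \<subseteq> {y. f y \<noteq> \<zero>}" by (auto simp: g_def)
      hence g: "g \<in> carrier (free_module R X)"
        using insert.prems(1) by (auto simp: free_module_simps g_def intro: finite_subset)
      have "P g" using insert.prems by (intro insert.IH g) (auto simp: g_def)
      moreover have "f = g \<oplus>\<^bsub>free_module R X\<^esub> f x \<odot>\<^bsub>free_module R X\<^esub> free_gen R x"
        using insert.prems(1) by (auto simp: free_module_simps g_def free_gen_def fun_eq_iff)
      ultimately show ?thesis
        using add[OF g _ _ x, of "f x"] insert.prems(1) by (simp add: free_module_simps(1))
    qed
  qed
  from this[of "{x. f x \<noteq> \<zero>}" f] f show ?thesis by (simp add: free_module_simps(1))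
qed

lemma (in cring) lin_maps_free_eqI:
  assumes "module R P" "\<phi> \<in> lin_maps R (free_module R X) P" "\<psi> \<in> lin_maps R (free_module R X) P"
    and "\<And>x. x \<in> X \<Longrightarrow> \<phi> (free_gen R x) = \<psi> (free_gen R x)"
    and "f \<in> carrier (free_module R X)"
  shows "\<phi> f = \<psi> f"
proof -
  interpret F: module R "free_module R X" by (rule free_module_module)
  show ?thesis using assms(5)
  proof (induction rule: free_module_induct)
    case zero
    show ?case using lin_maps_zero[OF F.module_axioms assms(1)] assms(2,3) by metis
  next
    case (add f a x)
    thus ?case using assms(2-4) by (simp add: lin_maps_add lin_maps_smult free_gen_closed)
  qed
qed

text \<open>\<open>lin_ext\<close> sums over the support of its argument, and this differs for f, g
  and f + g. The summands outside the support are zero, so all these sums can be taken over one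
  common finite set and compared there.\<close>

lemma (in cring) lin_ext_eq_finsum:
  assumes "module R P" "f \<in> carrier (free_module R X)" "g \<in> X \<rightarrow> carrier P"
    and "finite A" "{x. f x \<noteq> \<zero>} \<subseteq> A" "A \<subseteq> X"
  shows "lin_ext R P g f = (\<Oplus>\<^bsub>P\<^esub>x\<in>A. f x \<odot>\<^bsub>P\<^esub> g x)"
proof -
  interpret P: module R P by fact
  show ?thesis unfolding lin_ext_def
    using assms(2-6) by (intro P.add.finprod_mono_neutral_cong_left)
      (auto simp: free_module_simps Pi_def subset_iff)
qed

lemma (in cring) lin_ext_lin_maps:
  assumes "module R P" "g \<in> X \<rightarrow> carrier P"
  shows "lin_ext R P g \<in> lin_maps R (free_module R X) P"
proof (rule lin_mapsI)
  interpret P: module R P by fact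
  interpret F: module R "free_module R X" by (rule free_module_module)
  note eq = lin_ext_eq_finsum[OF assms(1) _ assms(2)]
  have closed: "f x \<odot>\<^bsub>P\<^esub> g x \<in> carrier P" if "f \<in> carrier (free_module R X)" "x \<in> X" for f x
    using that assms(2) by (auto simp: free_module_simps)
  fix f assume f: "f \<in> carrier (free_module R X)"
  hence fin: "finite {x. f x \<noteq> \<zero>}" "{x. f x \<noteq> \<zero>} \<subseteq> X"
    by (auto simp: free_module_simps)
  show "lin_ext R P g f \<in> carrier P"
    unfolding lin_ext_def using closed[OF f] fin by (intro P.finsum_closed) auto
  {
    fix h assume h: "h \<in> carrier (free_module R X)"
    define A where "A = {x. f x \<noteq> \<zero>} \<union> {x. h x \<noteq> \<zero>}"
    have A: "finite A" "A \<subseteq> X"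
      using f h by (auto simp: A_def free_module_simps)
    have "lin_ext R P g (f \<oplus>\<^bsub>free_module R X\<^esub> h) = (\<Oplus>\<^bsub>P\<^esub>x\<in>A. (f x \<oplus> h x) \<odot>\<^bsub>P\<^esub> g x)"
      using eq[of "f \<oplus>\<^bsub>free_module R X\<^esub> h", OF F.M.a_closed[OF f h] A(1) _ A(2)] f h
      by (fastforce simp: free_module_simps A_def)
    also have "\<dots> = (\<Oplus>\<^bsub>P\<^esub>x\<in>A. f x \<odot>\<^bsub>P\<^esub> g x \<oplus>\<^bsub>P\<^esub> h x \<odot>\<^bsub>P\<^esub> g x)"
      using f h A(2) assms(2) closed[OF f] closed[OF h]
      by (intro P.M.finsum_cong') (auto simp: free_module_simps P.smult_l_distr Pi_def subset_iff)
    also have "\<dots> = (\<Oplus>\<^bsub>P\<^esub>x\<in>A. f x \<odot>\<^bsub>P\<^esub> g x) \<oplus>\<^bsub>P\<^esub> (\<Oplus>\<^bsub>P\<^esub>x\<in>A. h x \<odot>\<^bsub>P\<^esub> g x)"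
      using closed[OF f] closed[OF h] A(2) by (intro P.finsum_addf) auto
    also have "\<dots> = lin_ext R P g f \<oplus>\<^bsub>P\<^esub> lin_ext R P g h"
      using eq[OF f A(1) _ A(2)] eq[OF h A(1) _ A(2)] by (simp add: A_def)
    finally show "lin_ext R P g (f \<oplus>\<^bsub>free_module R X\<^esub> h) = lin_ext R P g f \<oplus>\<^bsub>P\<^esub> lin_ext R P g h" .
  }
  fix a assume a: "a \<in> carrier R"
  have "lin_ext R P g (a \<odot>\<^bsub>free_module R X\<^esub> f) = (\<Oplus>\<^bsub>P\<^esub>x\<in>{x. f x \<noteq> \<zero>}. (a \<otimes> f x) \<odot>\<^bsub>P\<^esub> g x)"
    using eq[OF F.smult_closed[OF a f] fin(1) _ fin(2)] a f by (fastforce simp: free_module_simps)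
  also have "\<dots> = (\<Oplus>\<^bsub>P\<^esub>x\<in>{x. f x \<noteq> \<zero>}. a \<odot>\<^bsub>P\<^esub> (f x \<odot>\<^bsub>P\<^esub> g x))"
    using a f fin(2) assms(2) closed[OF f]
    by (intro P.M.finsum_cong') (auto simp: free_module_simps P.smult_assoc1 Pi_def subset_iff)
  also have "\<dots> = a \<odot>\<^bsub>P\<^esub> lin_ext R P g f"
    unfolding lin_ext_def
    using a fin closed[OF f] by (intro P.finsum_smult_ldistr[symmetric]) auto
  finally show "lin_ext R P g (a \<odot>\<^bsub>free_module R X\<^esub> f) = a \<odot>\<^bsub>P\<^esub> lin_ext R P g f" .
qed

lemma (in cring) lin_ext_free_gen:
  assumes "module R P" "g x \<in> carrier P"
  shows "lin_ext R P g (free_gen R x) = g x"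
proof -
  interpret P: module R P by fact
  \<comment> \<open>Summing over \<open>{x}\<close> instead of the support also covers the zero
    ring, where the support of a generator is empty. Taking \<open>{x}\<close> as the index set
    requires only the value of \<open>g\<close> at \<open>x\<close> to lie in
    \<open>P\<close>.\<close>
  have "lin_ext R P g (free_gen R x) = (\<Oplus>\<^bsub>P\<^esub>y\<in>{x}. free_gen R x y \<odot>\<^bsub>P\<^esub> g y)"
    using assms(2) free_gen_closed[of x "{x}"]
    by (intro lin_ext_eq_finsum[OF assms(1), where X="{x}"]) (auto simp: free_gen_def)
  also have "\<dots> = g x"
    using assms(2) by (simp add: free_gen_def)
  finally show ?thesis .
qed

section \<open>Quotient modules\<close>

lemma quot_module_simps:
  "carrier (quot_module R M N) = a_rcosets\<^bsub>M\<^esub> N"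
  "\<zero>\<^bsub>quot_module R M N\<^esub> = N"
  "A \<oplus>\<^bsub>quot_module R M N\<^esub> B = A <+>\<^bsub>M\<^esub> B"
  "a \<odot>\<^bsub>quot_module R M N\<^esub> A = (\<Union>x\<in>A. N +>\<^bsub>M\<^esub> (a \<odot>\<^bsub>M\<^esub> x))"
  by (simp_all add: quot_module_def)

lemma (in module) submodule_imp_abelian_subgroup:
  assumes "submodule N R M"
  shows "abelian_subgroup N M"
  using assms by (intro abelian_subgroupI3 additive_subgroupI submodule.axioms abelian_group_axioms)

text \<open>The scalar multiple in the quotient is a union over all representatives. Two of them
  differ by an element of N, which stays in N when multiplied by a, so the union is of copies of a
  single coset.\<close>

lemma (in module) quot_smult_coset:
  assumes "submodule N R M" "a \<in> carrier R" "x \<in> carrier M"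
  shows "a \<odot>\<^bsub>quot_module R M N\<^esub> (N +>\<^bsub>M\<^esub> x) = N +>\<^bsub>M\<^esub> (a \<odot>\<^bsub>M\<^esub> x)"
proof -
  interpret N: abelian_subgroup N M by (rule submodule_imp_abelian_subgroup[OF assms(1)])
  have "N +>\<^bsub>M\<^esub> (a \<odot>\<^bsub>M\<^esub> y) = N +>\<^bsub>M\<^esub> (a \<odot>\<^bsub>M\<^esub> x)" if "y \<in> N +>\<^bsub>M\<^esub> x" for y
  proof -
    obtain h where h: "h \<in> N" "y = h \<oplus>\<^bsub>M\<^esub> x" using \<open>y \<in> N +>\<^bsub>M\<^esub> x\<close> by (auto simp: a_r_coset_def')
    have hM: "h \<in> carrier M" using h(1) by simp
    have "a \<odot>\<^bsub>M\<^esub> y = a \<odot>\<^bsub>M\<^esub> h \<oplus>\<^bsub>M\<^esub> a \<odot>\<^bsub>M\<^esub> x"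
      using h(2) hM assms by (simp add: smult_r_distr)
    moreover have "a \<odot>\<^bsub>M\<^esub> h \<in> N" using submoduleE(4)[OF assms(1)] assms h by blast
    ultimately have "a \<odot>\<^bsub>M\<^esub> y \<in> N +>\<^bsub>M\<^esub> (a \<odot>\<^bsub>M\<^esub> x)" by (auto simp: a_r_coset_def')
    thus ?thesis using N.a_repr_independence'[of "a \<odot>\<^bsub>M\<^esub> y" "a \<odot>\<^bsub>M\<^esub> x"] assms by simp
  qed
  moreover have "x \<in> N +>\<^bsub>M\<^esub> x" using assms by (simp add: N.a_rcos_self)
  ultimately show ?thesis unfolding quot_module_simps by blast
qed

lemma (in module) quot_module_module:
  assumes "submodule N R M"
  shows "module R (quot_module R M N)"
proof (intro moduleI is_cring)
  interpret N: abelian_subgroup N M by (rule submodule_imp_abelian_subgroup[OF assms])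
  have N: "N \<in> a_rcosets\<^bsub>M\<^esub> N" by (simp add: N.a_subgroup_in_rcosets)
  have cos: "\<exists>x\<in>carrier M. A = N +>\<^bsub>M\<^esub> x" if "A \<in> a_rcosets\<^bsub>M\<^esub> N" for A
    using that by (auto simp: A_RCOSETS_def')
  have mem: "N +>\<^bsub>M\<^esub> x \<in> a_rcosets\<^bsub>M\<^esub> N" if "x \<in> carrier M" for x
    using that by (auto simp: A_RCOSETS_def')
  note sm = quot_smult_coset[OF assms]
  show "abelian_group (quot_module R M N)"
  proof (rule abelian_groupI)
    fix A B assume "A \<in> carrier (quot_module R M N)" "B \<in> carrier (quot_module R M N)"
    then obtain x y where "x \<in> carrier M" "y \<in> carrier M" "A = N +>\<^bsub>M\<^esub> x" "B = N +>\<^bsub>M\<^esub> y"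
      unfolding quot_module_simps using cos by meson
    thus "A \<oplus>\<^bsub>quot_module R M N\<^esub> B = B \<oplus>\<^bsub>quot_module R M N\<^esub> A"
      by (simp add: quot_module_simps N.a_rcos_sum a_comm)
  next
    fix A assume "A \<in> carrier (quot_module R M N)"
    thus "\<exists>B\<in>carrier (quot_module R M N). B \<oplus>\<^bsub>quot_module R M N\<^esub> A = \<zero>\<^bsub>quot_module R M N\<^esub>"
      using N.a_rcosets_inv_mult_group_eq N.a_setinv_closed unfolding quot_module_simps by blast
  qed (auto simp: quot_module_simps N N.a_setmult_closed N.a_rcosets_assoc N.rcosets_add_eq)
  fix a A assume a: "a \<in> carrier R" and "A \<in> carrier (quot_module R M N)"
  then obtain x where x: "x \<in> carrier M" "A = N +>\<^bsub>M\<^esub> x"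
    unfolding quot_module_simps using cos by meson
  show "a \<odot>\<^bsub>quot_module R M N\<^esub> A \<in> carrier (quot_module R M N)"
    using a x by (simp add: sm) (simp add: quot_module_simps mem)
  fix b assume b: "b \<in> carrier R"
  show "(a \<otimes> b) \<odot>\<^bsub>quot_module R M N\<^esub> A = a \<odot>\<^bsub>quot_module R M N\<^esub> (b \<odot>\<^bsub>quot_module R M N\<^esub> A)"
    using a b x by (simp add: sm smult_assoc1)
  show "(a \<oplus> b) \<odot>\<^bsub>quot_module R M N\<^esub> A
      = a \<odot>\<^bsub>quot_module R M N\<^esub> A \<oplus>\<^bsub>quot_module R M N\<^esub> b \<odot>\<^bsub>quot_module R M N\<^esub> A"
    using a b x by (simp add: sm smult_l_distr quot_module_simps(3) N.a_rcos_sum)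
next
  fix A assume "A \<in> carrier (quot_module R M N)"
  then obtain x where "x \<in> carrier M" "A = N +>\<^bsub>M\<^esub> x"
    by (auto simp: quot_module_simps A_RCOSETS_def')
  thus "\<one> \<odot>\<^bsub>quot_module R M N\<^esub> A = A" by (simp add: quot_smult_coset[OF assms])
next
  interpret N: abelian_subgroup N M by (rule submodule_imp_abelian_subgroup[OF assms])
  fix a A B assume a: "a \<in> carrier R"
    and "A \<in> carrier (quot_module R M N)" "B \<in> carrier (quot_module R M N)"
  then obtain x y where xy: "x \<in> carrier M" "A = N +>\<^bsub>M\<^esub> x" "y \<in> carrier M" "B = N +>\<^bsub>M\<^esub> y"
    by (auto simp: quot_module_simps A_RCOSETS_def')
  show "a \<odot>\<^bsub>quot_module R M N\<^esub> (A \<oplus>\<^bsub>quot_module R M N\<^esub> B)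
      = a \<odot>\<^bsub>quot_module R M N\<^esub> A \<oplus>\<^bsub>quot_module R M N\<^esub> a \<odot>\<^bsub>quot_module R M N\<^esub> B"
    using a xy quot_smult_coset[OF assms]
    by (simp add: quot_module_simps(3) N.a_rcos_sum smult_r_distr)
qed

lemma (in module) quot_proj_lin_maps:
  assumes "submodule N R M"
  shows "(\<lambda>x. N +>\<^bsub>M\<^esub> x) \<in> lin_maps R M (quot_module R M N)"
proof -
  interpret N: abelian_subgroup N M by (rule submodule_imp_abelian_subgroup[OF assms])
  show ?thesis
    by (rule lin_mapsI) (auto simp: quot_smult_coset[OF assms] quot_module_simps(1,3) N.a_rcos_sum
      A_RCOSETS_def')
qed

section \<open>Tensor products\<close>

definition bilin_maps ::
    "('r, 'm) ring_scheme \<Rightarrow> ('r, 'a, 'm1) module_scheme \<Rightarrow> ('r, 'b, 'm2) module_scheme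
      \<Rightarrow> ('r, 'p, 'm3) module_scheme \<Rightarrow> ('a \<Rightarrow> 'b \<Rightarrow> 'p) set"
  where "bilin_maps R M N P = {h. (\<forall>x\<in>carrier M. h x \<in> lin_maps R N P) \<and>
    (\<forall>y\<in>carrier N. (\<lambda>x. h x y) \<in> lin_maps R M P)}"

lemma bilin_mapsI:
  assumes "\<And>x. x \<in> carrier M \<Longrightarrow> h x \<in> lin_maps R N P"
    and "\<And>y. y \<in> carrier N \<Longrightarrow> (\<lambda>x. h x y) \<in> lin_maps R M P"
  shows "h \<in> bilin_maps R M N P"
  using assms by (simp add: bilin_maps_def)

lemma bilin_maps_left: "\<lbrakk>h \<in> bilin_maps R M N P; y \<in> carrier N\<rbrakk> \<Longrightarrow> (\<lambda>x. h x y) \<in> lin_maps R M P"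
  and bilin_maps_right: "\<lbrakk>h \<in> bilin_maps R M N P; x \<in> carrier M\<rbrakk> \<Longrightarrow> h x \<in> lin_maps R N P"
  and bilin_maps_closed: "\<lbrakk>h \<in> bilin_maps R M N P; x \<in> carrier M; y \<in> carrier N\<rbrakk> \<Longrightarrow> h x y \<in> carrier P"
  by (auto simp: bilin_maps_def lin_maps_def)

lemma bilin_maps_flip: "h \<in> bilin_maps R M N P \<Longrightarrow> (\<lambda>y x. h x y) \<in> bilin_maps R N M P"
  by (simp add: bilin_maps_def)

lemma bilin_maps_comp:
  assumes "h \<in> bilin_maps R M N P" "f \<in> lin_maps R M' M" "g \<in> lin_maps R N' N"
  shows "(\<lambda>x y. h (f x) (g y)) \<in> bilin_maps R M' N' P"
  using lin_maps_closed[OF assms(2)] lin_maps_closed[OF assms(3)]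
    lin_maps_comp[OF assms(2) bilin_maps_left[OF assms(1)]]
    lin_maps_comp[OF assms(3) bilin_maps_right[OF assms(1)]]
  by (auto intro!: bilin_mapsI)

lemma kernel_submodule:
  assumes "module R M" "module R P" "\<phi> \<in> lin_maps R M P"
  shows "submodule {x \<in> carrier M. \<phi> x = \<zero>\<^bsub>P\<^esub>} R M"
proof -
  interpret M: module R M by fact
  interpret P: module R P by fact
  show ?thesis
    using lin_maps_zero[OF assms] lin_maps_uminus[OF assms] lin_maps_add[OF assms(3)]
      lin_maps_smult[OF assms(3)]
    by (intro M.submoduleI) auto
qed

section \<open>The universal property of the tensor product\<close>

locale tensor_pair = cring R + M: module R M + N: module R N
  for R :: "('r, 'm) ring_scheme" (structure)
    and M :: "('r, 'a, 'm1) module_scheme" and N :: "('r, 'b, 'm2) module_scheme"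
begin

abbreviation "F \<equiv> free_module R (carrier M \<times> carrier N)"
abbreviation "T \<equiv> tensor R M N"
abbreviation "K \<equiv> tensor_sub R M N"
abbreviation "te \<equiv> tensor_elem R M N"

sublocale F: module R F
  by (rule free_module_module)

lemma gen_closed: "\<lbrakk>x \<in> carrier M; y \<in> carrier N\<rbrakk> \<Longrightarrow> free_gen R (x, y) \<in> carrier F"
  by (simp add: free_gen_closed)

lemma tensor_rels_subset: "tensor_rels R M N \<subseteq> carrier F"
  unfolding tensor_rels_def Let_def
  by (intro Un_least subsetI; elim CollectE exE conjE; hypsubst;
      intro F.M.minus_closed F.M.a_closed F.smult_closed gen_closed M.M.a_closed N.M.a_closed
        M.smult_closed N.smult_closed; assumption)

lemma tensor_sub_submodule: "submodule K R F"
proof (rule F.submoduleI)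
  \<comment> \<open>\<open>F\<close> itself belongs to the family intersected in \<open>K\<close>,
    so the intersection does not degenerate to the whole type.\<close>
  show "K \<subseteq> carrier F"
    unfolding tensor_sub_def using F.carrier_is_submodule tensor_rels_subset by blast
  show "\<zero>\<^bsub>F\<^esub> \<in> K"
    unfolding tensor_sub_def using subgroup.one_closed[OF submodule.axioms(1)] by fastforce
next
  fix u assume "u \<in> K"
  thus "\<ominus>\<^bsub>F\<^esub> u \<in> K"
    unfolding tensor_sub_def by (auto simp: F.submoduleE(3))
next
  fix u v assume "u \<in> K" "v \<in> K"
  thus "u \<oplus>\<^bsub>F\<^esub> v \<in> K"
    unfolding tensor_sub_def by (auto simp: F.submoduleE(5))
next
  fix a u assume "a \<in> carrier R" "u \<in> K"
  thus "a \<odot>\<^bsub>F\<^esub> u \<in> K"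
    unfolding tensor_sub_def by (auto simp: F.submoduleE(4))
qed

lemma tensor_rels_subset_sub: "tensor_rels R M N \<subseteq> K"
  unfolding tensor_sub_def by blast

sublocale K: abelian_subgroup K F
  by (rule F.submodule_imp_abelian_subgroup[OF tensor_sub_submodule])

lemma tensor_module: "module R T"
  unfolding tensor_def by (rule F.quot_module_module[OF tensor_sub_submodule])

lemma proj_lin_maps: "(\<lambda>f. K +>\<^bsub>F\<^esub> f) \<in> lin_maps R F T"
  unfolding tensor_def by (rule F.quot_proj_lin_maps[OF tensor_sub_submodule])

lemma tensor_carrierE:
  assumes "t \<in> carrier T"
  obtains f where "f \<in> carrier F" "t = K +>\<^bsub>F\<^esub> f"
  using assms unfolding tensor_def quot_module_simps A_RCOSETS_def' by blast

lemma tensor_elem_closed: "\<lbrakk>x \<in> carrier M; y \<in> carrier N\<rbrakk> \<Longrightarrow> te x y \<in> carrier T"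
  unfolding tensor_elem_def by (intro lin_maps_closed[OF proj_lin_maps] gen_closed)

lemma proj_eqI:
  assumes "f \<in> carrier F" "g \<in> carrier F" "f \<ominus>\<^bsub>F\<^esub> g \<in> tensor_rels R M N"
  shows "K +>\<^bsub>F\<^esub> f = K +>\<^bsub>F\<^esub> g"
proof -
  have "f \<in> K +>\<^bsub>F\<^esub> g"
    using assms tensor_rels_subset_sub K.a_rcos_module unfolding a_minus_def by blast
  thus ?thesis using assms K.a_repr_independence' by metis
qed

lemma tensor_relsI:
  "\<lbrakk>x \<in> carrier M; x' \<in> carrier M; y \<in> carrier N\<rbrakk> \<Longrightarrow> free_gen R (x \<oplus>\<^bsub>M\<^esub> x', y)
    \<ominus>\<^bsub>F\<^esub> (free_gen R (x, y) \<oplus>\<^bsub>F\<^esub> free_gen R (x', y)) \<in> tensor_rels R M N"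
  "\<lbrakk>x \<in> carrier M; y \<in> carrier N; y' \<in> carrier N\<rbrakk> \<Longrightarrow> free_gen R (x, y \<oplus>\<^bsub>N\<^esub> y')
    \<ominus>\<^bsub>F\<^esub> (free_gen R (x, y) \<oplus>\<^bsub>F\<^esub> free_gen R (x, y')) \<in> tensor_rels R M N"
  "\<lbrakk>a \<in> carrier R; x \<in> carrier M; y \<in> carrier N\<rbrakk> \<Longrightarrow> free_gen R (a \<odot>\<^bsub>M\<^esub> x, y)
    \<ominus>\<^bsub>F\<^esub> a \<odot>\<^bsub>F\<^esub> free_gen R (x, y) \<in> tensor_rels R M N"
  "\<lbrakk>a \<in> carrier R; x \<in> carrier M; y \<in> carrier N\<rbrakk> \<Longrightarrow> free_gen R (x, a \<odot>\<^bsub>N\<^esub> y)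
    \<ominus>\<^bsub>F\<^esub> a \<odot>\<^bsub>F\<^esub> free_gen R (x, y) \<in> tensor_rels R M N"
  unfolding tensor_rels_def Let_def by blast+

lemma tensor_elem_bilin: "te \<in> bilin_maps R M N T"
proof -
  \<comment> \<open>Used from right to left, these rules turn both sides into cosets of single
    elements of \<open>F\<close> whose difference is a defining relation.\<close>
  note p = lin_maps_add[OF proj_lin_maps, symmetric] lin_maps_smult[OF proj_lin_maps, symmetric]
  have l: "te (x \<oplus>\<^bsub>M\<^esub> x') y = te x y \<oplus>\<^bsub>T\<^esub> te x' y"
    if "x \<in> carrier M" "x' \<in> carrier M" "y \<in> carrier N" for x x' y
    unfolding tensor_elem_def using that
    by (simp add: p gen_closed proj_eqI tensor_relsI)
  have r: "te x (y \<oplus>\<^bsub>N\<^esub> y') = te x y \<oplus>\<^bsub>T\<^esub> te x y'"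
    if "x \<in> carrier M" "y \<in> carrier N" "y' \<in> carrier N" for x y y'
    unfolding tensor_elem_def using that
    by (simp add: p gen_closed proj_eqI tensor_relsI)
  have sl: "te (a \<odot>\<^bsub>M\<^esub> x) y = a \<odot>\<^bsub>T\<^esub> te x y"
    if "a \<in> carrier R" "x \<in> carrier M" "y \<in> carrier N" for a x y
    unfolding tensor_elem_def using that
    by (simp add: p gen_closed proj_eqI tensor_relsI)
  have sr: "te x (a \<odot>\<^bsub>N\<^esub> y) = a \<odot>\<^bsub>T\<^esub> te x y"
    if "a \<in> carrier R" "x \<in> carrier M" "y \<in> carrier N" for a x y
    unfolding tensor_elem_def using that
    by (simp add: p gen_closed proj_eqI tensor_relsI)
  show ?thesis
    by (intro bilin_mapsI lin_mapsI) (simp_all add: l r sl sr tensor_elem_closed)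
qed

text \<open>Composed with the projection from \<open>F\<close>, both maps become linear maps on a
  free module, and the generators of \<open>F\<close> go to the elementary tensors.\<close>

lemma lin_maps_tensor_eqI:
  assumes "module R P" "\<phi> \<in> lin_maps R T P" "\<psi> \<in> lin_maps R T P"
    and "\<And>x y. \<lbrakk>x \<in> carrier M; y \<in> carrier N\<rbrakk> \<Longrightarrow> \<phi> (te x y) = \<psi> (te x y)"
    and "t \<in> carrier T"
  shows "\<phi> t = \<psi> t"
proof -
  obtain f where f: "f \<in> carrier F" "t = K +>\<^bsub>F\<^esub> f"
    using assms(5) by (rule tensor_carrierE)
  have "\<phi> (K +>\<^bsub>F\<^esub> f) = \<psi> (K +>\<^bsub>F\<^esub> f)"
    using assms(4) unfolding tensor_elem_def
    by (intro lin_maps_free_eqI[OF assms(1) lin_maps_comp[OF proj_lin_maps assms(2)]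
      lin_maps_comp[OF proj_lin_maps assms(3)] _ f(1)]) auto
  thus ?thesis using f(2) by simp
qed

context
  fixes P :: "('r, 'p, 'm3) module_scheme" and h :: "'a \<Rightarrow> 'b \<Rightarrow> 'p"
  assumes P: "module R P" and h: "h \<in> bilin_maps R M N P"
begin

lemma lin_ext_pair_lin_maps: "lin_ext R P (\<lambda>(x, y). h x y) \<in> lin_maps R F P"
  using bilin_maps_closed[OF h] by (intro lin_ext_lin_maps P) auto

lemma lin_ext_pair_gen:
  "\<lbrakk>x \<in> carrier M; y \<in> carrier N\<rbrakk> \<Longrightarrow> lin_ext R P (\<lambda>(x, y). h x y) (free_gen R (x, y)) = h x y"
  using bilin_maps_closed[OF h] by (subst lin_ext_free_gen) (auto simp: P)

text \<open>Bilinearity of \<open>h\<close> says that its linear extension kills the four families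
  of relations. The kernel is a submodule, so it contains \<open>K\<close>, the least submodule with
  these relations.\<close>

lemma lin_ext_pair_sub: "u \<in> K \<Longrightarrow> lin_ext R P (\<lambda>(x, y). h x y) u = \<zero>\<^bsub>P\<^esub>"
proof -
  interpret P: module R P by (rule P)
  let ?\<phi> = "lin_ext R P (\<lambda>(x, y). h x y)"
  let ?ker = "{u \<in> carrier F. ?\<phi> u = \<zero>\<^bsub>P\<^esub>}"
  note \<phi> = lin_ext_pair_lin_maps
  note hs = bilin_maps_closed[OF h] lin_maps_add[OF bilin_maps_left[OF h]]
    lin_maps_add[OF bilin_maps_right[OF h]] lin_maps_smult[OF bilin_maps_left[OF h]]
    lin_maps_smult[OF bilin_maps_right[OF h]]
  have minus_self: "p \<ominus>\<^bsub>P\<^esub> p = \<zero>\<^bsub>P\<^esub>" if "p \<in> carrier P" for p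
    using that by (simp add: a_minus_def P.M.r_neg)
  have "?\<phi> u = \<zero>\<^bsub>P\<^esub>" if "u \<in> tensor_rels R M N" for u
    using that unfolding tensor_rels_def Let_def
    by (elim UnE CollectE exE conjE; hypsubst)
      (simp_all add: lin_maps_minus[OF F.module_axioms P \<phi>] lin_maps_add[OF \<phi>] lin_maps_smult[OF \<phi>]
        gen_closed lin_ext_pair_gen hs minus_self)
  hence "K \<subseteq> ?ker"
    unfolding tensor_sub_def
    using kernel_submodule[OF F.module_axioms P \<phi>] tensor_rels_subset by blast
  thus "u \<in> K \<Longrightarrow> ?\<phi> u = \<zero>\<^bsub>P\<^esub>" by blast
qed

text \<open>Representatives of a coset differ by elements of \<open>K\<close>, where the linear
  extension is zero. Its image of the coset is therefore a singleton, as \<open>the_elem\<close> in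
  \<open>tensor_lift\<close> requires.\<close>

lemma tensor_lift_coset:
  assumes "f \<in> carrier F"
  shows "tensor_lift R P h (K +>\<^bsub>F\<^esub> f) = lin_ext R P (\<lambda>(x, y). h x y) f"
proof -
  interpret P: module R P by (rule P)
  let ?\<phi> = "lin_ext R P (\<lambda>(x, y). h x y)"
  have "?\<phi> g = ?\<phi> f" if g: "g \<in> K +>\<^bsub>F\<^esub> f" for g
  proof -
    obtain u where u: "u \<in> K" "g = u \<oplus>\<^bsub>F\<^esub> f" using g unfolding a_r_coset_def' by blast
    hence "?\<phi> g = ?\<phi> u \<oplus>\<^bsub>P\<^esub> ?\<phi> f"
      using lin_maps_add[OF lin_ext_pair_lin_maps] assms K.a_subset by blast
    thus ?thesis
      using lin_ext_pair_sub[OF u(1)] lin_maps_closed[OF lin_ext_pair_lin_maps assms] by simp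
  qed
  moreover have "f \<in> K +>\<^bsub>F\<^esub> f" using assms by (rule K.a_rcos_self)
  ultimately have "?\<phi> ` (K +>\<^bsub>F\<^esub> f) = {?\<phi> f}" by blast
  thus ?thesis by (simp add: tensor_lift_def)
qed

lemma tensor_lift_lin_maps: "tensor_lift R P h \<in> lin_maps R T P"
proof (rule lin_mapsI)
  note p = lin_maps_add[OF proj_lin_maps, symmetric] lin_maps_smult[OF proj_lin_maps, symmetric]
  note l = lin_maps_closed[OF lin_ext_pair_lin_maps] lin_maps_add[OF lin_ext_pair_lin_maps]
    lin_maps_smult[OF lin_ext_pair_lin_maps]
  fix t assume "t \<in> carrier T"
  then obtain f where f: "f \<in> carrier F" "t = K +>\<^bsub>F\<^esub> f" by (rule tensor_carrierE)
  show "tensor_lift R P h t \<in> carrier P"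
    using f by (simp add: tensor_lift_coset l)
  {
    fix s assume "s \<in> carrier T"
    then obtain g where g: "g \<in> carrier F" "s = K +>\<^bsub>F\<^esub> g" by (rule tensor_carrierE)
    show "tensor_lift R P h (t \<oplus>\<^bsub>T\<^esub> s) = tensor_lift R P h t \<oplus>\<^bsub>P\<^esub> tensor_lift R P h s"
      using f g by (simp add: p tensor_lift_coset l)
  }
  fix a assume "a \<in> carrier R"
  thus "tensor_lift R P h (a \<odot>\<^bsub>T\<^esub> t) = a \<odot>\<^bsub>P\<^esub> tensor_lift R P h t"
    using f by (simp add: p tensor_lift_coset l)
qed

lemma tensor_lift_elem:
  "\<lbrakk>x \<in> carrier M; y \<in> carrier N\<rbrakk> \<Longrightarrow> tensor_lift R P h (te x y) = h x y"
  unfolding tensor_elem_def by (simp add: tensor_lift_coset gen_closed lin_ext_pair_gen)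

end

text \<open>Makes nested lifts possible, as in the associativity maps. Linearity in the parameter z
  need only be checked on elementary tensors, where the lift of \<open>H z\<close> is
  \<open>H z x y\<close>.\<close>

lemma tensor_lift_bilin:
  assumes P: "module R P" and H: "\<And>z. z \<in> carrier Q \<Longrightarrow> H z \<in> bilin_maps R M N P"
    and Hz: "\<And>x y. \<lbrakk>x \<in> carrier M; y \<in> carrier N\<rbrakk> \<Longrightarrow> (\<lambda>z. H z x y) \<in> lin_maps R Q P"
    and Q: "module R Q"
  shows "(\<lambda>z t. tensor_lift R P (H z) t) \<in> bilin_maps R Q T P"
proof (rule bilin_mapsI)
  interpret P: module R P by (rule P)
  interpret Q: module R Q by (rule Q)
  note lift = tensor_lift_lin_maps[OF P H]
  show "tensor_lift R P (H z) \<in> lin_maps R T P" if "z \<in> carrier Q" for z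
    using that by (rule lift)
  fix t assume t: "t \<in> carrier T"
  show "(\<lambda>z. tensor_lift R P (H z) t) \<in> lin_maps R Q P"
  proof (rule lin_mapsI)
    fix z assume z: "z \<in> carrier Q"
    show "tensor_lift R P (H z) t \<in> carrier P" by (rule lin_maps_closed[OF lift[OF z] t])
    {
      fix w assume w: "w \<in> carrier Q"
      show "tensor_lift R P (H (z \<oplus>\<^bsub>Q\<^esub> w)) t = tensor_lift R P (H z) t \<oplus>\<^bsub>P\<^esub> tensor_lift R P (H w) t"
        by (rule lin_maps_tensor_eqI[OF P lift[OF Q.M.a_closed[OF z w]] lin_maps_add_map[OF P lift[OF z] lift[OF w]] _ t])
          (simp add: tensor_lift_elem[OF P H] z w lin_maps_add[OF Hz])
    }
    fix a assume a: "a \<in> carrier R"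
    show "tensor_lift R P (H (a \<odot>\<^bsub>Q\<^esub> z)) t = a \<odot>\<^bsub>P\<^esub> tensor_lift R P (H z) t"
      by (rule lin_maps_tensor_eqI[OF P lift[OF Q.smult_closed[OF a z]] lin_maps_smult_map[OF P lift[OF z] a] _ t])
        (simp add: tensor_lift_elem[OF P H] z a lin_maps_smult[OF Hz])
  qed
qed

lemma tensor_map_lin_maps:
  assumes "tensor_pair R M' N'" "f \<in> lin_maps R M M'" "g \<in> lin_maps R N N'"
  shows "tensor_map R M' N' f g \<in> lin_maps R T (tensor R M' N')"
  unfolding tensor_map_def
  by (intro tensor_lift_lin_maps bilin_maps_comp[OF _ assms(2,3)]
    tensor_pair.tensor_module[OF assms(1)] tensor_pair.tensor_elem_bilin[OF assms(1)])

lemma tensor_map_elem: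
  assumes "tensor_pair R M' N'" "f \<in> lin_maps R M M'" "g \<in> lin_maps R N N'"
    and "x \<in> carrier M" "y \<in> carrier N"
  shows "tensor_map R M' N' f g (te x y) = tensor_elem R M' N' (f x) (g y)"
  unfolding tensor_map_def using assms(4,5)
  by (intro tensor_lift_elem bilin_maps_comp[OF _ assms(2,3)]
    tensor_pair.tensor_module[OF assms(1)] tensor_pair.tensor_elem_bilin[OF assms(1)])

end

section \<open>The associativity maps\<close>

lemma (in cring) tensor_pairI: "\<lbrakk>module R M; module R N\<rbrakk> \<Longrightarrow> tensor_pair R M N"
  by (intro tensor_pair.intro is_cring)

lemma (in cring) tensor_assoc_lin_maps:
  assumes "module R L" "module R M" "module R N"
  shows "tensor_assoc R L M N \<in> lin_maps R (tensor R (tensor R L M) N) (tensor R L (tensor R M N))"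
    and "\<lbrakk>x \<in> carrier L; y \<in> carrier M; z \<in> carrier N\<rbrakk> \<Longrightarrow>
      tensor_assoc R L M N (tensor_elem R (tensor R L M) N (tensor_elem R L M x y) z) =
      tensor_elem R L (tensor R M N) x (tensor_elem R M N y z)"
proof -
  interpret LM: tensor_pair R L M by (intro tensor_pairI assms)
  interpret MN: tensor_pair R M N by (intro tensor_pairI assms)
  interpret LM_N: tensor_pair R "tensor R L M" N by (intro tensor_pairI assms LM.tensor_module)
  interpret L_MN: tensor_pair R L "tensor R M N" by (intro tensor_pairI assms MN.tensor_module)
  let ?P = "tensor R L (tensor R M N)"
  let ?H = "\<lambda>z x y. L_MN.te x (MN.te y z)"
  have H: "?H z \<in> bilin_maps R L M ?P" if "z \<in> carrier N" for z
    by (rule bilin_maps_comp[OF L_MN.tensor_elem_bilin lin_maps_id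
      bilin_maps_left[OF MN.tensor_elem_bilin that]])
  have Hz: "(\<lambda>z. ?H z x y) \<in> lin_maps R N ?P" if "x \<in> carrier L" "y \<in> carrier M" for x y
    by (rule lin_maps_comp[OF bilin_maps_right[OF MN.tensor_elem_bilin that(2)]
      bilin_maps_right[OF L_MN.tensor_elem_bilin that(1)]])
  \<comment> \<open>\<open>tensor_assoc\<close> has the lifted tensor as first argument and the
    parameter z as second, the reverse of \<open>tensor_lift_bilin\<close>; hence the flip.\<close>
  have bil: "(\<lambda>t z. tensor_lift R ?P (?H z) t) \<in> bilin_maps R (tensor R L M) N ?P"
    by (rule bilin_maps_flip, rule LM.tensor_lift_bilin[OF L_MN.tensor_module H Hz assms(3)])
  show "tensor_assoc R L M N \<in> lin_maps R (tensor R (tensor R L M) N) ?P"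
    unfolding tensor_assoc_def Let_def
    by (rule LM_N.tensor_lift_lin_maps[OF L_MN.tensor_module bil])
  show "\<lbrakk>x \<in> carrier L; y \<in> carrier M; z \<in> carrier N\<rbrakk> \<Longrightarrow>
      tensor_assoc R L M N (LM_N.te (LM.te x y) z) = L_MN.te x (MN.te y z)"
    unfolding tensor_assoc_def Let_def
    by (simp add: LM_N.tensor_lift_elem[OF L_MN.tensor_module bil] LM.tensor_elem_closed
      LM.tensor_lift_elem[OF L_MN.tensor_module H])
qed

lemma (in cring) tensor_assoc_inv_lin_maps:
  assumes "module R L" "module R M" "module R N"
  shows "tensor_assoc_inv R L M N \<in> lin_maps R (tensor R L (tensor R M N)) (tensor R (tensor R L M) N)"
    and "\<lbrakk>x \<in> carrier L; y \<in> carrier M; z \<in> carrier N\<rbrakk> \<Longrightarrow>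
      tensor_assoc_inv R L M N (tensor_elem R L (tensor R M N) x (tensor_elem R M N y z)) =
      tensor_elem R (tensor R L M) N (tensor_elem R L M x y) z"
proof -
  interpret LM: tensor_pair R L M by (intro tensor_pairI assms)
  interpret MN: tensor_pair R M N by (intro tensor_pairI assms)
  interpret LM_N: tensor_pair R "tensor R L M" N by (intro tensor_pairI assms LM.tensor_module)
  interpret L_MN: tensor_pair R L "tensor R M N" by (intro tensor_pairI assms MN.tensor_module)
  let ?P = "tensor R (tensor R L M) N"
  let ?H = "\<lambda>x y z. LM_N.te (LM.te x y) z"
  have H: "?H x \<in> bilin_maps R M N ?P" if "x \<in> carrier L" for x
    by (rule bilin_maps_comp[OF LM_N.tensor_elem_bilin
      bilin_maps_right[OF LM.tensor_elem_bilin that] lin_maps_id])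
  have Hx: "(\<lambda>x. ?H x y z) \<in> lin_maps R L ?P" if "y \<in> carrier M" "z \<in> carrier N" for y z
    by (rule lin_maps_comp[OF bilin_maps_left[OF LM.tensor_elem_bilin that(1)]
      bilin_maps_left[OF LM_N.tensor_elem_bilin that(2)]])
  have bil: "(\<lambda>x t. tensor_lift R ?P (?H x) t) \<in> bilin_maps R L (tensor R M N) ?P"
    by (rule MN.tensor_lift_bilin[OF LM_N.tensor_module H Hx assms(1)])
  show "tensor_assoc_inv R L M N \<in> lin_maps R (tensor R L (tensor R M N)) ?P"
    unfolding tensor_assoc_inv_def Let_def
    by (rule L_MN.tensor_lift_lin_maps[OF LM_N.tensor_module bil])
  show "\<lbrakk>x \<in> carrier L; y \<in> carrier M; z \<in> carrier N\<rbrakk> \<Longrightarrow>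
      tensor_assoc_inv R L M N (L_MN.te x (MN.te y z)) = LM_N.te (LM.te x y) z"
    unfolding tensor_assoc_inv_def Let_def
    by (simp add: L_MN.tensor_lift_elem[OF LM_N.tensor_module bil] MN.tensor_elem_closed
      MN.tensor_lift_elem[OF LM_N.tensor_module H])
qed

section \<open>Extension from generators\<close>

text \<open>Generation by \<open>G\<close>, encoded as the property that is used: linear maps into
  \<open>P\<close> are determined by their values on \<open>G\<close>. This form passes to tensor
  products without any spans. The target is a parameter because one definition cannot range over
  modules of all types.\<close>

definition determining :: "('r, 'm) ring_scheme \<Rightarrow> ('r, 'a, 'm1) module_scheme
    \<Rightarrow> ('r, 'p, 'm2) module_scheme \<Rightarrow> 'a set \<Rightarrow> bool"
  where "determining R M P G \<longleftrightarrow> G \<subseteq> carrier M \<and>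
    (\<forall>\<phi>\<in>lin_maps R M P. \<forall>\<psi>\<in>lin_maps R M P. (\<forall>x\<in>G. \<phi> x = \<psi> x) \<longrightarrow> (\<forall>x\<in>carrier M. \<phi> x = \<psi> x))"

lemma determiningD:
  assumes "determining R M P G" "\<phi> \<in> lin_maps R M P" "\<psi> \<in> lin_maps R M P"
    and "\<And>x. x \<in> G \<Longrightarrow> \<phi> x = \<psi> x" "x \<in> carrier M"
  shows "\<phi> x = \<psi> x"
  using assms unfolding determining_def by blast

lemma (in cring) determining_free_gen:
  "module R P \<Longrightarrow> determining R (free_module R X) P (free_gen R ` X)"
  unfolding determining_def
proof (intro conjI ballI impI)
  show "free_gen R ` X \<subseteq> carrier (free_module R X)" by (auto simp: free_gen_closed)
  fix \<phi> \<psi> f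
  assume P: "module R P"
    and \<phi>: "\<phi> \<in> lin_maps R (free_module R X) P" and \<psi>: "\<psi> \<in> lin_maps R (free_module R X) P"
    and eq: "\<forall>x\<in>free_gen R ` X. \<phi> x = \<psi> x" and f: "f \<in> carrier (free_module R X)"
  show "\<phi> f = \<psi> f"
    by (rule lin_maps_free_eqI[OF P \<phi> \<psi> _ f]) (simp add: eq)
qed

text \<open>One factor is freed at a time: for x in \<open>G\<close> the two maps agree at
  \<open>te x y\<close> for all y, by linearity in y; then linearity in x frees x as well.\<close>

lemma (in tensor_pair) determining_tensor:
  assumes "module R P" "determining R M P G" "determining R N P H"
  shows "determining R T P {te x y | x y. x \<in> G \<and> y \<in> H}"
  unfolding determining_def
proof (intro conjI ballI impI)
  have GH: "G \<subseteq> carrier M" "H \<subseteq> carrier N"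
    using assms by (auto simp: determining_def)
  thus "{te x y | x y. x \<in> G \<and> y \<in> H} \<subseteq> carrier T"
    using tensor_elem_closed by blast
  fix \<phi> \<psi> t
  assume \<phi>: "\<phi> \<in> lin_maps R T P" and \<psi>: "\<psi> \<in> lin_maps R T P" and t: "t \<in> carrier T"
    and eq: "\<forall>u\<in>{te x y | x y. x \<in> G \<and> y \<in> H}. \<phi> u = \<psi> u"
  show "\<phi> t = \<psi> t"
  proof (rule lin_maps_tensor_eqI[OF assms(1) \<phi> \<psi> _ t])
    fix x y assume x: "x \<in> carrier M" and y: "y \<in> carrier N"
    have *: "\<phi> (te x y) = \<psi> (te x y)" if "x \<in> G" for x
    proof -
      have x: "x \<in> carrier M" using GH that by blast
      show ?thesis
        by (rule determiningD[OF assms(3) lin_maps_comp[OF bilin_maps_right[OF tensor_elem_bilin x] \<phi>]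
          lin_maps_comp[OF bilin_maps_right[OF tensor_elem_bilin x] \<psi>] _ y]) (use eq that in blast)
    qed
    show "\<phi> (te x y) = \<psi> (te x y)"
      by (rule determiningD[OF assms(2) lin_maps_comp[OF bilin_maps_left[OF tensor_elem_bilin y] \<phi>]
        lin_maps_comp[OF bilin_maps_left[OF tensor_elem_bilin y] \<psi>] * x])
  qed
qed

text \<open>Linearity in u holds by construction. Linearity in v is not obtained by exchanging sums:
  both sides are linear in u, so they are compared at generators, where only the inner extension in
  v remains.\<close>

lemma (in cring) lin_ext_bilin:
  assumes P: "module R P" and g: "\<And>x y. \<lbrakk>x \<in> X; y \<in> Y\<rbrakk> \<Longrightarrow> g x y \<in> carrier P"
  shows "(\<lambda>u v. lin_ext R P (\<lambda>x. lin_ext R P (g x) v) u)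
    \<in> bilin_maps R (free_module R X) (free_module R Y) P"
proof -
  interpret P: module R P by (rule P)
  interpret X: module R "free_module R X" by (rule free_module_module)
  interpret Y: module R "free_module R Y" by (rule free_module_module)
  have inner: "lin_ext R P (g x) \<in> lin_maps R (free_module R Y) P" if "x \<in> X" for x
    using g[OF that] by (intro lin_ext_lin_maps P) auto
  let ?h = "\<lambda>v. lin_ext R P (\<lambda>x. lin_ext R P (g x) v)"
  have outer: "?h v \<in> lin_maps R (free_module R X) P" if "v \<in> carrier (free_module R Y)" for v
    using that by (intro lin_ext_lin_maps P) (auto simp: lin_maps_closed[OF inner])
  have gen: "?h v (free_gen R x) = lin_ext R P (g x) v"
    if "x \<in> X" "v \<in> carrier (free_module R Y)" for x v
    using that by (intro lin_ext_free_gen P lin_maps_closed[OF inner])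
  show ?thesis
  proof (rule bilin_mapsI[OF _ outer])
    fix u assume u: "u \<in> carrier (free_module R X)"
    show "(\<lambda>v. ?h v u) \<in> lin_maps R (free_module R Y) P"
    proof (rule lin_mapsI)
      fix v assume v: "v \<in> carrier (free_module R Y)"
      show "?h v u \<in> carrier P" by (rule lin_maps_closed[OF outer[OF v] u])
      {
        fix w assume w: "w \<in> carrier (free_module R Y)"
        note vw = Y.M.a_closed[OF v w]
        show "?h (v \<oplus>\<^bsub>free_module R Y\<^esub> w) u = ?h v u \<oplus>\<^bsub>P\<^esub> ?h w u"
          by (rule lin_maps_free_eqI[OF P outer[OF vw] lin_maps_add_map[OF P outer[OF v] outer[OF w]] _ u])
            (simp only: gen v w vw lin_maps_add[OF inner])
      }
      fix a assume a: "a \<in> carrier R"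
      note av = Y.smult_closed[OF a v]
      show "?h (a \<odot>\<^bsub>free_module R Y\<^esub> v) u = a \<odot>\<^bsub>P\<^esub> ?h v u"
        by (rule lin_maps_free_eqI[OF P outer[OF av] lin_maps_smult_map[OF P outer[OF v] a] _ u])
          (simp only: gen v av a lin_maps_smult[OF inner])
    qed
  qed
qed

section \<open>Linear maps given by their values on pairs of basis vectors\<close>

lemma (in cring) slq_module: "module R (slq R n)"
  unfolding slq_def by (rule free_module_module)

lemma (in cring) slq_bilin:
  assumes P: "module R P"
    and g: "\<And>x y. \<lbrakk>x \<in> sl_basis n; y \<in> sl_basis n\<rbrakk> \<Longrightarrow> g x y \<in> carrier P"
  shows "slq_bilin R P g \<in> lin_maps R (tensor R (slq R n) (slq R n)) P"
    and "\<lbrakk>x \<in> sl_basis n; y \<in> sl_basis n\<rbrakk> \<Longrightarrow>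
      slq_bilin R P g (tensor_elem R (slq R n) (slq R n) (free_gen R x) (free_gen R y)) = g x y"
proof -
  interpret LL: tensor_pair R "slq R n" "slq R n"
    by (intro tensor_pairI slq_module)
  have b: "(\<lambda>u v. lin_ext R P (\<lambda>x. lin_ext R P (g x) v) u) \<in> bilin_maps R (slq R n) (slq R n) P"
    unfolding slq_def by (intro lin_ext_bilin P g)
  show "slq_bilin R P g \<in> lin_maps R LL.T P"
    unfolding slq_bilin_def by (rule LL.tensor_lift_lin_maps[OF P b])
  assume x: "x \<in> sl_basis n" and y: "y \<in> sl_basis n"
  have inner: "lin_ext R P (g x) (free_gen R y) = g x y"
    using x y by (intro lin_ext_free_gen P g)
  have "slq_bilin R P g (LL.te (free_gen R x) (free_gen R y))
      = lin_ext R P (\<lambda>x. lin_ext R P (g x) (free_gen R y)) (free_gen R x)"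
    unfolding slq_bilin_def using x y
    by (intro LL.tensor_lift_elem[OF P b]) (auto simp: slq_def free_gen_closed)
  also have "\<dots> = lin_ext R P (g x) (free_gen R y)"
    using x y by (intro lin_ext_free_gen P) (simp add: inner g)
  finally show "slq_bilin R P g (LL.te (free_gen R x) (free_gen R y)) = g x y"
    by (simp add: inner)
qed

section \<open>Matrix units\<close>

lemma mat_unit_carrier: "mat_unit n x \<in> carrier_mat (n + 1) (n + 1)"
  by (cases x) (simp add: mat_unit_def)

text \<open>The inner index has to lie in the range: for b = i outside it both factors are zero
  matrices, while \<open>mat_unit n (a, j)\<close> need not be zero.\<close>

lemma mat_unit_mult:
  assumes "1 \<le> b" "b \<le> n + 1"
  shows "mat_unit n (a, b) * mat_unit n (i, j) =
    (if b = i then mat_unit n (a, j) else 0\<^sub>m (n + 1) (n + 1))"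
proof (rule eq_matI)
  fix r s
  assume rs: "r < dim_row (if b = i then mat_unit n (a, j) else 0\<^sub>m (n + 1) (n + 1))"
    "s < dim_col (if b = i then mat_unit n (a, j) else 0\<^sub>m (n + 1) (n + 1))"
  hence rs: "r < n + 1" "s < n + 1" by (auto simp: mat_unit_def split: if_splits)
  have "(mat_unit n (a, b) * mat_unit n (i, j)) $$ (r, s) =
      (\<Sum>k = 0..<n + 1. mat_unit n (a, b) $$ (r, k) * mat_unit n (i, j) $$ (k, s))"
    using rs by (subst index_mult_mat(1))
      (auto simp: mat_unit_def scalar_prod_def simp del: sum.op_ivl_Suc intro!: sum.cong)
  \<comment> \<open>Only the summand at b - 1 survives: indices of matrix units start at 1, those of
    matrix entries at 0.\<close>
  also have "\<dots> = (\<Sum>k = 0..<n + 1. if k = b - 1 then (if r + 1 = a \<and> b = i \<and> s + 1 = j then 1 else 0) else 0)"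
    using rs assms by (intro sum.cong) (auto simp: mat_unit_def)
  also have "\<dots> = (if r + 1 = a \<and> b = i \<and> s + 1 = j then 1 else 0)"
    using assms by (subst sum.delta) auto
  also have "\<dots> = (if b = i then mat_unit n (a, j) else 0\<^sub>m (n + 1) (n + 1)) $$ (r, s)"
    using rs by (auto simp: mat_unit_def)
  finally show "(mat_unit n (a, b) * mat_unit n (i, j)) $$ (r, s) = \<dots>" .
qed (auto simp: mat_unit_def)

lemma transpose_mat_unit: "transpose_mat (mat_unit n (a, b)) = mat_unit n (b, a)"
  by (rule eq_matI) (auto simp: mat_unit_def)

lemma commutator_mat_unit:
  assumes "(a, b) \<in> sl_basis n" "(i, j) \<in> sl_basis n"
  shows "commutator (mat_unit n (a, b)) (mat_unit n (i, j)) =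
    (if b = i then mat_unit n (a, j) else 0\<^sub>m (n + 1) (n + 1)) -
    (if j = a then mat_unit n (i, b) else 0\<^sub>m (n + 1) (n + 1))"
  using assms unfolding commutator_def sl_basis_def by (auto simp: mat_unit_mult)

lemma (in ring) usual_bracket_composable:
  assumes "(a, b) \<in> sl_basis n" "(b, j) \<in> sl_basis n"
  shows "usual_bracket R n (a, b) (b, j) = free_gen R (a, j)"
proof
  fix x :: "nat \<times> nat"
  obtain r s where x: "x = (r, s)" by (cases x)
  \<comment> \<open>As a < b < j, the product in the opposite order is zero and the commutator is a
    single matrix unit.\<close>
  have "j \<noteq> a" using assms by (auto simp: sl_basis_def)
  thus "usual_bracket R n (a, b) (b, j) x = free_gen R (a, j) x"
    using assms unfolding usual_bracket_def x commutator_mat_unit[OF assms]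
    by (auto simp: mat_unit_def free_gen_def sl_basis_def add_pow_int_ge)
qed

lemma (in ring) usual_bracket_not_composable:
  assumes "(a, b) \<in> sl_basis n" "(i, j) \<in> sl_basis n" "b \<noteq> i" "j \<noteq> a"
  shows "usual_bracket R n (a, b) (i, j) = (\<lambda>x. \<zero>)"
  using assms(3,4) unfolding usual_bracket_def commutator_mat_unit[OF assms(1,2)]
  by (auto simp: sl_basis_def add_pow_int_ge fun_eq_iff)

text \<open>Here h_ab = e_aa - e_bb, and e_ij is an eigenvector of the commutator with e_aa, with
  eigenvalue [a = i] - [a = j]. So c is the value of the root of e_ij at the coroot of e_ab.\<close>

lemma c_coeff_eq:
  assumes "(a, b) \<in> sl_basis n" "(i, j) \<in> sl_basis n"
  shows "c_coeff n (a, b) (i, j) = of_bool (a = i) - of_bool (a = j) - of_bool (b = i) + of_bool (b = j)"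
    (is "_ = ?c")
proof -
  have ab: "1 \<le> a" "a \<le> n + 1" "1 \<le> b" "b \<le> n + 1" "a < b" and ij: "1 \<le> i" "i \<le> n + 1" "1 \<le> j" "j \<le> n + 1"
    using assms by (auto simp: sl_basis_def)
  have h: "h_mat n (a, b) = mat_unit n (a, a) - mat_unit n (b, b)"
    unfolding h_mat_def commutator_def transpose_mat_unit using ab by (simp add: mat_unit_mult)
  have com: "commutator (h_mat n (a, b)) (mat_unit n (i, j)) = ?c \<cdot>\<^sub>m mat_unit n (i, j)"
  proof -
    have "commutator (h_mat n (a, b)) (mat_unit n (i, j)) =
      (mat_unit n (a, a) * mat_unit n (i, j) - mat_unit n (b, b) * mat_unit n (i, j)) -
      (mat_unit n (i, j) * mat_unit n (a, a) - mat_unit n (i, j) * mat_unit n (b, b))"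
      unfolding commutator_def h
      by (simp only: minus_mult_distrib_mat[OF mat_unit_carrier mat_unit_carrier mat_unit_carrier]
        mult_minus_distrib_mat[OF mat_unit_carrier mat_unit_carrier mat_unit_carrier])
    also have "\<dots> = ?c \<cdot>\<^sub>m mat_unit n (i, j)"
      unfolding mat_unit_mult[OF ab(1,2)] mat_unit_mult[OF ab(3,4)] mat_unit_mult[OF ij(3,4)]
      by (rule eq_matI) (auto simp: mat_unit_def)
    finally show ?thesis .
  qed
  \<comment> \<open>Uniqueness for the \<open>THE\<close> in \<open>c_coeff\<close>: the entry of
    e_ij at its own position is 1, so it recovers the scalar.\<close>
  have "c = ?c" if "?c \<cdot>\<^sub>m mat_unit n (i, j) = c \<cdot>\<^sub>m mat_unit n (i, j)" for c
    using arg_cong[OF that, of "\<lambda>A. A $$ (i - 1, j - 1)"] ij by (simp add: mat_unit_def)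
  thus ?thesis unfolding c_coeff_def com by (intro the_equality) auto
qed

section \<open>The quantised bracket\<close>

locale slq_bracket_setting = cring R for R :: "('r, 'm) ring_scheme" (structure) +
  fixes q :: 'r and n :: nat
  assumes q_unit: "q \<in> Units R"
begin

abbreviation "L \<equiv> slq R n"
abbreviation "e \<equiv> free_gen R"
abbreviation "T \<equiv> tensor R L L"
abbreviation "te \<equiv> tensor_elem R L L"
abbreviation "\<beta> \<equiv> slq_bracket R q n"
abbreviation "\<gamma> \<equiv> (\<lambda>t. t \<ominus>\<^bsub>T\<^esub> slq_S R q n t)"

text \<open>The coefficient with which S flips two basis vectors, see \<open>S_gen\<close>;
  \<open>br\<close> plays the same part for the bracket, see \<open>beta_gen\<close>.\<close>

definition chi :: "nat \<times> nat \<Rightarrow> nat \<times> nat \<Rightarrow> 'r"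
  where "chi x y = (if x = y then \<one> else if basis_less x y then q [^] c_coeff n x y
    else q [^] (- c_coeff n y x))"

definition br :: "nat \<times> nat \<Rightarrow> nat \<times> nat \<Rightarrow> nat \<times> nat \<Rightarrow> 'r"
  where "br x y = (if x = y then \<zero>\<^bsub>L\<^esub> else if basis_less x y then usual_bracket R n x y
    else \<ominus>\<^bsub>L\<^esub> (q [^] (- c_coeff n y x) \<odot>\<^bsub>L\<^esub> usual_bracket R n y x))"

lemma module_L: "module R L"
  by (rule slq_module)

sublocale LL: tensor_pair R L L
  by (intro tensor_pairI module_L)

lemma module_T: "module R T"
  by (rule LL.tensor_module)

sublocale T: module R T
  by (rule module_T)

lemma tensor_pair_T_L: "tensor_pair R T L" and tensor_pair_L_T: "tensor_pair R L T"
  by (intro tensor_pairI module_L module_T)+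

sublocale TL: tensor_pair R T L
  by (rule tensor_pair_T_L)

sublocale LT: tensor_pair R L T
  by (rule tensor_pair_L_T)

lemma basis_less_linear:
  "x = y \<and> \<not> basis_less x y \<or> x \<noteq> y \<and> basis_less x y \<and> \<not> basis_less y x \<or>
    x \<noteq> y \<and> \<not> basis_less x y \<and> basis_less y x"
  by (cases x; cases y; simp add: basis_less_def; linarith)

lemma e_closed: "x \<in> sl_basis n \<Longrightarrow> e x \<in> carrier L"
  by (simp add: slq_def free_gen_closed)

lemma q_closed: "q \<in> carrier R" "inv q \<in> carrier R"
  using Units_closed[OF q_unit] Units_inv_closed[OF q_unit] by simp_all

text \<open>A negative power is the inverse of a natural power, and it lies in R because natural
  powers of a unit are units.\<close>

lemma int_pow_closed: "q [^] (z :: int) \<in> carrier R"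
proof -
  have "q [^] k \<in> Units R" for k :: nat
    by (induction k) (simp_all add: q_unit)
  thus ?thesis by (simp add: int_pow_def2 Units_closed del: pow_nat)
qed

lemma chi_closed: "chi x y \<in> carrier R"
  by (simp add: chi_def int_pow_closed)

lemma usual_bracket_closed:
  assumes "x \<in> sl_basis n" "y \<in> sl_basis n"
  shows "usual_bracket R n x y \<in> carrier L"
proof -
  have "{z. usual_bracket R n x y z \<noteq> \<zero>} \<subseteq> sl_basis n"
    by (auto simp: usual_bracket_def split: if_splits)
  moreover have "finite (sl_basis n)"
    by (rule finite_subset[of _ "{..n + 1} \<times> {..n + 1}"]) (auto simp: sl_basis_def)
  moreover have "usual_bracket R n x y z \<in> carrier R" for z
    by (cases z) (simp add: usual_bracket_def add.int_pow_closed)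
  ultimately show ?thesis
    by (auto simp: slq_def free_module_simps intro: finite_subset)
qed

lemma br_closed: "\<lbrakk>x \<in> sl_basis n; y \<in> sl_basis n\<rbrakk> \<Longrightarrow> br x y \<in> carrier L"
  by (simp add: br_def usual_bracket_closed int_pow_closed)

lemma zero_L: "\<zero>\<^bsub>L\<^esub> = (\<lambda>x. \<zero>)"
  by (simp add: slq_def free_module_simps)

section \<open>The bracket and the coefficients of S on basis vectors\<close>

lemma sl_basis_trans: "\<lbrakk>(a, b) \<in> sl_basis n; (b, j) \<in> sl_basis n\<rbrakk> \<Longrightarrow> (a, j) \<in> sl_basis n"
  by (auto simp: sl_basis_def)

text \<open>Of the four coincidences counted in \<open>c_coeff_eq\<close> only the one between the
  end of the first pair and the start of the second occurs, and it counts -1.\<close>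

lemma c_coeff_composable:
  "\<lbrakk>(a, b) \<in> sl_basis n; (b, j) \<in> sl_basis n\<rbrakk> \<Longrightarrow> c_coeff n (a, b) (b, j) = - 1"
  by (subst c_coeff_eq) (auto simp: sl_basis_def)

lemma br_composable:
  assumes "(a, b) \<in> sl_basis n" "(b, j) \<in> sl_basis n"
  shows "br (a, b) (b, j) = e (a, j)"
proof -
  have "a \<noteq> b" "basis_less (a, b) (b, j)"
    using assms by (auto simp: sl_basis_def basis_less_def)
  thus ?thesis by (simp add: br_def usual_bracket_composable assms)
qed

text \<open>The pair is decreasing, so its bracket is minus the S-coefficient times the bracket of
  the increasing pair; that coefficient is q to the power -c with c = -1.\<close>

lemma br_composable_rev:
  assumes "(a, b) \<in> sl_basis n" "(b, j) \<in> sl_basis n"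
  shows "br (b, j) (a, b) = (\<ominus> q) \<odot>\<^bsub>L\<^esub> e (a, j)"
proof -
  have "b \<noteq> a" "\<not> basis_less (b, j) (a, b)"
    using assms by (auto simp: sl_basis_def basis_less_def)
  thus ?thesis
    using e_closed[OF sl_basis_trans[OF assms]] q_closed
    by (simp add: br_def usual_bracket_composable c_coeff_composable assms int_pow_def2 LL.M.smult_l_minus del: pow_nat)
qed

text \<open>The matrix products vanish in both orders, so every branch of \<open>br\<close> gives
  zero, whichever of the two basis vectors is smaller.\<close>

lemma br_not_composable:
  assumes "(a, b) \<in> sl_basis n" "(i, j) \<in> sl_basis n" "b \<noteq> i" "j \<noteq> a"
  shows "br (a, b) (i, j) = \<zero>\<^bsub>L\<^esub>"
  using assms int_pow_closed
  by (simp add: br_def usual_bracket_not_composable zero_L[symmetric])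

lemma chi_composable:
  assumes "(a, b) \<in> sl_basis n" "(b, j) \<in> sl_basis n"
  shows "chi (a, b) (b, j) = inv q" "chi (b, j) (a, b) = q"
proof -
  have "a \<noteq> b" "basis_less (a, b) (b, j)" "\<not> basis_less (b, j) (a, b)"
    using assms by (auto simp: sl_basis_def basis_less_def)
  thus "chi (a, b) (b, j) = inv q" "chi (b, j) (a, b) = q"
    using q_closed by (auto simp: chi_def c_coeff_composable assms int_pow_def2 simp del: pow_nat)
qed

text \<open>None of the coincidences counted in \<open>c_coeff_eq\<close> occurs, so the exponent is
  zero in either order. This serves the two ends of a chain.\<close>

lemma chi_disjoint:
  assumes "(a, b) \<in> sl_basis n" "(i, j) \<in> sl_basis n" "{a, b} \<inter> {i, j} = {}"
  shows "chi (a, b) (i, j) = \<one>"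
  using assms by (auto simp: chi_def c_coeff_eq)

section \<open>The bracket, S and 1 - S as linear maps\<close>

lemma beta_lin_maps: "\<beta> \<in> lin_maps R T L"
  and beta_gen: "\<lbrakk>x \<in> sl_basis n; y \<in> sl_basis n\<rbrakk> \<Longrightarrow> \<beta> (te (e x) (e y)) = br x y"
proof -
  have "\<beta> = slq_bilin R L br"
    by (simp add: slq_bracket_def br_def[abs_def] Let_def)
  thus "\<beta> \<in> lin_maps R T L" "\<lbrakk>x \<in> sl_basis n; y \<in> sl_basis n\<rbrakk> \<Longrightarrow> \<beta> (te (e x) (e y)) = br x y"
    using slq_bilin[OF module_L br_closed] by auto
qed

lemma S_lin_maps: "slq_S R q n \<in> lin_maps R T T"
  and S_gen: "\<lbrakk>x \<in> sl_basis n; y \<in> sl_basis n\<rbrakk> \<Longrightarrow>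
    slq_S R q n (te (e x) (e y)) = chi x y \<odot>\<^bsub>T\<^esub> te (e y) (e x)"
proof -
  have eq: "slq_S R q n = slq_bilin R T (\<lambda>x y. chi x y \<odot>\<^bsub>T\<^esub> te (e y) (e x))"
    by (simp add: slq_S_def chi_def[abs_def] Let_def)
  have cl: "chi x y \<odot>\<^bsub>T\<^esub> te (e y) (e x) \<in> carrier T" if "x \<in> sl_basis n" "y \<in> sl_basis n" for x y
    using that by (intro T.smult_closed chi_closed LL.tensor_elem_closed e_closed)
  show "slq_S R q n \<in> lin_maps R T T"
    unfolding eq by (intro slq_bilin(1) module_T cl)
  assume "x \<in> sl_basis n" "y \<in> sl_basis n"
  thus "slq_S R q n (te (e x) (e y)) = chi x y \<odot>\<^bsub>T\<^esub> te (e y) (e x)"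
    unfolding eq by (intro slq_bilin(2)[OF module_T] cl)
qed

lemma gamma_lin_maps: "\<gamma> \<in> lin_maps R T T"
  by (intro lin_maps_minus_map module_T lin_maps_id S_lin_maps)

lemma determining_L: "module R P \<Longrightarrow> determining R L P (e ` sl_basis n)"
  unfolding slq_def by (rule determining_free_gen)

lemma determining_T:
  "module R P \<Longrightarrow> determining R T P {te u v | u v. u \<in> e ` sl_basis n \<and> v \<in> e ` sl_basis n}"
  by (intro LL.determining_tensor determining_L)

text \<open>\<open>\<beta>\<close> factors as \<open>\<eta> \<circ> \<gamma>\<close> where \<open>\<eta>\<close> is the bracket on increasing pairs of basis vectors
  and zero on the others.\<close>

lemma antisymmetry:
  assumes t: "t \<in> carrier T" and "\<gamma> t = \<zero>\<^bsub>T\<^esub>"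
  shows "\<beta> t = \<zero>\<^bsub>L\<^esub>"
proof -
  define h where "h = (\<lambda>x y. if basis_less x y then usual_bracket R n x y else \<zero>\<^bsub>L\<^esub>)"
  define \<eta> where "\<eta> = slq_bilin R L h"
  have h: "h x y \<in> carrier L" if "x \<in> sl_basis n" "y \<in> sl_basis n" for x y
    using that by (simp add: h_def usual_bracket_closed)
  have \<eta>: "\<eta> \<in> lin_maps R T L"
    unfolding \<eta>_def by (intro slq_bilin module_L h)
  have \<eta>_gen: "\<eta> (te (e x) (e y)) = h x y" if "x \<in> sl_basis n" "y \<in> sl_basis n" for x y
    unfolding \<eta>_def using that by (intro slq_bilin module_L h)
  have "\<beta> t = \<eta> (\<gamma> t)"
  proof (rule determiningD[OF determining_T[OF module_L] beta_lin_maps lin_maps_comp[OF gamma_lin_maps \<eta>] _ t])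
    fix u assume "u \<in> {te u v | u v. u \<in> e ` sl_basis n \<and> v \<in> e ` sl_basis n}"
    then obtain x y where xy: "x \<in> sl_basis n" "y \<in> sl_basis n" and u: "u = te (e x) (e y)"
      by blast
    have te: "te (e x) (e y) \<in> carrier T" "te (e y) (e x) \<in> carrier T"
      using xy by (simp_all add: LL.tensor_elem_closed e_closed)
    have "\<eta> (\<gamma> u) = h x y \<ominus>\<^bsub>L\<^esub> chi x y \<odot>\<^bsub>L\<^esub> h y x"
      using te xy chi_closed[of x y]
      by (simp add: u S_gen lin_maps_minus[OF module_T module_L \<eta>] lin_maps_smult[OF \<eta>] \<eta>_gen)
    \<comment> \<open>On an increasing pair \<open>h y x\<close> is zero and \<open>h x y\<close> is
      the bracket. On a decreasing pair \<open>h x y\<close> is zero and the second term is how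
      \<open>br\<close> is defined there. On the diagonal everything is zero.\<close>
    also have "\<dots> = br x y"
    proof -
      consider "x = y" "\<not> basis_less x y" | "x \<noteq> y" "basis_less x y" "\<not> basis_less y x"
        | "x \<noteq> y" "\<not> basis_less x y" "basis_less y x"
        using basis_less_linear[of x y] by blast
      thus ?thesis
        using usual_bracket_closed xy int_pow_closed chi_closed
        by cases (auto simp: h_def br_def chi_def a_minus_def)
    qed
    finally show "\<beta> u = \<eta> (\<gamma> u)" by (simp add: u beta_gen xy)
  qed
  thus ?thesis using assms(2) lin_maps_zero[OF module_T module_L \<eta>] by simp
qed

section \<open>The Jacobi identities\<close>

lemma bracket_bilin: "(\<lambda>u v. \<beta> (te u v)) \<in> bilin_maps R L L L"
  using lin_maps_comp[OF bilin_maps_left[OF LL.tensor_elem_bilin] beta_lin_maps]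
    lin_maps_comp[OF bilin_maps_right[OF LL.tensor_elem_bilin] beta_lin_maps]
  by (auto intro!: bilin_mapsI)

lemma bracket_zero:
  "u \<in> carrier L \<Longrightarrow> \<beta> (te u \<zero>\<^bsub>L\<^esub>) = \<zero>\<^bsub>L\<^esub>"
  "u \<in> carrier L \<Longrightarrow> \<beta> (te \<zero>\<^bsub>L\<^esub> u) = \<zero>\<^bsub>L\<^esub>"
  using lin_maps_zero[OF module_L module_L bilin_maps_right[OF bracket_bilin]]
    lin_maps_zero[OF module_L module_L bilin_maps_left[OF bracket_bilin]] by auto

lemma bracket_smult:
  "\<lbrakk>a \<in> carrier R; u \<in> carrier L; v \<in> carrier L\<rbrakk> \<Longrightarrow> \<beta> (te u (a \<odot>\<^bsub>L\<^esub> v)) = a \<odot>\<^bsub>L\<^esub> \<beta> (te u v)"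
  "\<lbrakk>a \<in> carrier R; u \<in> carrier L; v \<in> carrier L\<rbrakk> \<Longrightarrow> \<beta> (te (a \<odot>\<^bsub>L\<^esub> u) v) = a \<odot>\<^bsub>L\<^esub> \<beta> (te u v)"
  using lin_maps_smult[OF bilin_maps_right[OF bracket_bilin]]
    lin_maps_smult[OF bilin_maps_left[OF bracket_bilin]] by auto

text \<open>Needed when S contributes the inverse of q to a term with two reversed brackets: of the
  product of their factors -q only q is left.\<close>

lemma q_cancel:
  "inv q \<otimes> (\<ominus> q \<otimes> \<ominus> q) = q" "inv q \<otimes> (q \<otimes> q) = q"
proof -
  have "inv q \<otimes> (q \<otimes> q) = q"
    using q_closed q_unit by (simp add: m_assoc[symmetric])
  thus "inv q \<otimes> (\<ominus> q \<otimes> \<ominus> q) = q" "inv q \<otimes> (q \<otimes> q) = q"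
    using q_closed by (simp_all add: l_minus r_minus)
qed

text \<open>Needed when the inner bracket on the left of a Jacobi identity joins the two ends of a
  chain: the left side is zero and the terms on the right carry -q and q.\<close>

lemma q_smult_cancel:
  assumes "u \<in> carrier L"
  shows "(\<ominus> q) \<odot>\<^bsub>L\<^esub> u \<oplus>\<^bsub>L\<^esub> q \<odot>\<^bsub>L\<^esub> u = \<zero>\<^bsub>L\<^esub>" "q \<odot>\<^bsub>L\<^esub> u \<oplus>\<^bsub>L\<^esub> (\<ominus> q) \<odot>\<^bsub>L\<^esub> u = \<zero>\<^bsub>L\<^esub>"
  using assms q_closed by (simp_all add: LL.M.smult_l_distr[symmetric] l_neg r_neg)

lemma minus_zero_L: "\<ominus>\<^bsub>L\<^esub> \<zero>\<^bsub>L\<^esub> = \<zero>\<^bsub>L\<^esub>"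
  by simp

text \<open>Only chains contribute, and their middle link decides. If it is y, then
  \<open>br x z\<close> is zero and the other two terms agree. If it is x, then
  \<open>br y z\<close> is zero and \<open>chi x y\<close>, which is q or its inverse, makes up for
  the exchange of x and y. If it is z, then \<open>br x y\<close> is zero, \<open>chi x y\<close> is
  1 and the two terms on the right cancel.\<close>

lemma left_jacobi_basis:
  assumes "x \<in> sl_basis n" "y \<in> sl_basis n" "z \<in> sl_basis n"
  shows "\<beta> (te (br x y) (e z)) =
    \<beta> (te (e x) (br y z)) \<ominus>\<^bsub>L\<^esub> chi x y \<odot>\<^bsub>L\<^esub> \<beta> (te (e y) (br x z))"
proof -
  obtain a b i j k l where x: "x = (a, b)" and y: "y = (i, j)" and z: "z = (k, l)"
    by (metis surj_pair)
  note mem = assms[unfolded x y z]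
  have lt: "a < b" "i < j" "k < l" using mem by (auto simp: sl_basis_def)
  have basis_iff: "(r, s) \<in> sl_basis n \<longleftrightarrow> 1 \<le> r \<and> r < s \<and> s \<le> n + 1" for r s
    by (simp add: sl_basis_def)
  \<comment> \<open>The reversed module rules collect all scalars into one coefficient in front of a
    basis vector, where the two cancellation lemmas apply.\<close>
  note s = beta_gen bracket_zero bracket_smult e_closed basis_iff br_composable br_composable_rev
    br_not_composable q_closed a_minus_def chi_composable chi_disjoint
    LL.M.smult_assoc1[symmetric] LL.M.smult_l_minus[symmetric] q_cancel q_smult_cancel chi_closed
  show ?thesis
  \<comment> \<open>The condition rules out the six chains. Two equations that close a cycle, such
    as b = i and j = a, contradict \<open>lt\<close>; two that share an index, such as b = i and b =
    k, leave the outer bracket nothing to match.\<close>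
  proof (cases "(b = i \<longrightarrow> j \<noteq> k \<and> l \<noteq> a) \<and> (j = a \<longrightarrow> b \<noteq> k \<and> l \<noteq> i) \<and>
    (j = k \<longrightarrow> l \<noteq> a) \<and> (l = i \<longrightarrow> b \<noteq> k)")
    case True
    have "\<beta> (te (br x y) (e z)) = \<zero>\<^bsub>L\<^esub>"
      using True mem lt unfolding x y z by (cases "b = i"; cases "j = a") (simp_all add: s)
    moreover have "\<beta> (te (e x) (br y z)) = \<zero>\<^bsub>L\<^esub>"
      using True mem lt unfolding x y z by (cases "j = k"; cases "l = i") (simp_all add: s)
    moreover have "\<beta> (te (e y) (br x z)) = \<zero>\<^bsub>L\<^esub>"
      using True mem lt unfolding x y z by (cases "b = k"; cases "l = a") (simp_all add: s)
    ultimately show ?thesis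
      using chi_closed[of x y] by (simp add: a_minus_def minus_zero_L)
  next
    case False
    hence "(b = i \<and> j = k) \<or> (b = i \<and> l = a) \<or> (j = a \<and> b = k) \<or> (j = a \<and> l = i) \<or>
        (j = k \<and> l = a) \<or> (l = i \<and> b = k)"
      by argo
    thus ?thesis using mem lt unfolding x y z by (elim disjE) (simp_all add: s)
  qed
qed

text \<open>The mirror image of \<open>left_jacobi_basis\<close>, with the same six chains. Middle
  link y again removes the term with \<open>br x z\<close>. Now \<open>chi y z\<close> is q or its
  inverse if the middle link is z, and it is 1 if the middle link is x.\<close>

lemma right_jacobi_basis:
  assumes "x \<in> sl_basis n" "y \<in> sl_basis n" "z \<in> sl_basis n"
  shows "\<beta> (te (e x) (br y z)) =
    \<beta> (te (br x y) (e z)) \<ominus>\<^bsub>L\<^esub> chi y z \<odot>\<^bsub>L\<^esub> \<beta> (te (br x z) (e y))"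
proof -
  obtain a b i j k l where x: "x = (a, b)" and y: "y = (i, j)" and z: "z = (k, l)"
    by (metis surj_pair)
  note mem = assms[unfolded x y z]
  have lt: "a < b" "i < j" "k < l" using mem by (auto simp: sl_basis_def)
  have basis_iff: "(r, s) \<in> sl_basis n \<longleftrightarrow> 1 \<le> r \<and> r < s \<and> s \<le> n + 1" for r s
    by (simp add: sl_basis_def)
  note s = beta_gen bracket_zero bracket_smult e_closed basis_iff br_composable br_composable_rev
    br_not_composable q_closed a_minus_def chi_composable chi_disjoint
    LL.M.smult_assoc1[symmetric] LL.M.smult_l_minus[symmetric] q_cancel q_smult_cancel chi_closed
  show ?thesis
  proof (cases "(b = i \<longrightarrow> j \<noteq> k \<and> l \<noteq> a) \<and> (j = a \<longrightarrow> b \<noteq> k \<and> l \<noteq> i) \<and>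
    (j = k \<longrightarrow> l \<noteq> a) \<and> (l = i \<longrightarrow> b \<noteq> k)")
    case True
    have "\<beta> (te (br x y) (e z)) = \<zero>\<^bsub>L\<^esub>"
      using True mem lt unfolding x y z by (cases "b = i"; cases "j = a") (simp_all add: s)
    moreover have "\<beta> (te (e x) (br y z)) = \<zero>\<^bsub>L\<^esub>"
      using True mem lt unfolding x y z by (cases "j = k"; cases "l = i") (simp_all add: s)
    moreover have "\<beta> (te (br x z) (e y)) = \<zero>\<^bsub>L\<^esub>"
      using True mem lt unfolding x y z by (cases "b = k"; cases "l = a") (simp_all add: s)
    ultimately show ?thesis
      using chi_closed[of y z] by (simp add: a_minus_def minus_zero_L)
  next
    case False
    hence "(b = i \<and> j = k) \<or> (b = i \<and> l = a) \<or> (j = a \<and> b = k) \<or> (j = a \<and> l = i) \<or>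
        (j = k \<and> l = a) \<or> (l = i \<and> b = k)"
      by argo
    thus ?thesis using mem lt unfolding x y z by (elim disjE) (simp_all add: s)
  qed
qed

section \<open>The Jacobi identities on all tensors\<close>

lemma left_jacobi_slq:
  assumes t: "t \<in> carrier (tensor R T L)"
  shows "\<beta> (tensor_map R L L \<beta> (\<lambda>x. x) t) =
    \<beta> (tensor_map R L L (\<lambda>x. x) \<beta> (tensor_assoc R L L L (tensor_map R T L \<gamma> (\<lambda>x. x) t)))"
proof -
  note LLp = LL.tensor_pair_axioms
  note map1 = TL.tensor_map_lin_maps[OF LLp beta_lin_maps lin_maps_id]
  note map2 = TL.tensor_map_lin_maps[OF tensor_pair_T_L gamma_lin_maps lin_maps_id]
  note assoc = tensor_assoc_lin_maps[OF module_L module_L module_L]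
  note map3 = LT.tensor_map_lin_maps[OF LLp lin_maps_id beta_lin_maps]
  let ?\<psi> = "\<lambda>s. \<beta> (tensor_map R L L (\<lambda>x. x) \<beta> (tensor_assoc R L L L s))"
  have \<psi>: "?\<psi> \<in> lin_maps R (tensor R T L) L"
    by (rule lin_maps_comp[OF lin_maps_comp[OF assoc(1) map3] beta_lin_maps])
  show ?thesis
  proof (rule determiningD[OF TL.determining_tensor[OF module_L determining_T[OF module_L] determining_L[OF module_L]]
        lin_maps_comp[OF map1 beta_lin_maps] lin_maps_comp[OF map2 \<psi>] _ t])
    fix w assume "w \<in> {TL.te u v | u v. u \<in> {te u v | u v. u \<in> e ` sl_basis n \<and> v \<in> e ` sl_basis n} \<and>
      v \<in> e ` sl_basis n}"
    then obtain x y z where mem: "x \<in> sl_basis n" "y \<in> sl_basis n" "z \<in> sl_basis n"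
      and w: "w = TL.te (te (e x) (e y)) (e z)" by blast
    note cl = e_closed[OF mem(1)] e_closed[OF mem(2)] e_closed[OF mem(3)]
    have te: "te (e x) (e y) \<in> carrier T" "te (e y) (e x) \<in> carrier T"
      by (simp_all add: LL.tensor_elem_closed cl)
    \<comment> \<open>1 - S maps a basis tensor to a difference that need not be an elementary
      tensor. Linearity in the first tensor factor, with e_z fixed, is what splits it.\<close>
    have \<psi>z: "(\<lambda>u. ?\<psi> (TL.te u (e z))) \<in> lin_maps R T L"
      by (rule lin_maps_comp[OF bilin_maps_left[OF TL.tensor_elem_bilin cl(3)] \<psi>])
    \<comment> \<open>Stated for arbitrary x and y because it is applied to both orders of the pair,
      S having exchanged them in the second term.\<close>
    have \<psi>_gen: "?\<psi> (TL.te (te (e x) (e y)) (e z)) = \<beta> (te (e x) (br y z))"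
      if "x \<in> sl_basis n" "y \<in> sl_basis n" for x y
      using that mem(3) by (simp add: assoc(2) LT.tensor_map_elem[OF LLp lin_maps_id beta_lin_maps]
        LL.tensor_elem_closed e_closed beta_gen)
    have "\<beta> (tensor_map R L L \<beta> (\<lambda>x. x) w) = \<beta> (te (br x y) (e z))"
      unfolding w using te cl mem
      by (simp add: TL.tensor_map_elem[OF LLp beta_lin_maps lin_maps_id] beta_gen)
    also have "\<dots> = \<beta> (te (e x) (br y z)) \<ominus>\<^bsub>L\<^esub> chi x y \<odot>\<^bsub>L\<^esub> \<beta> (te (e y) (br x z))"
      by (rule left_jacobi_basis[OF mem])
    also have "\<dots> = ?\<psi> (TL.te (te (e x) (e y) \<ominus>\<^bsub>T\<^esub> chi x y \<odot>\<^bsub>T\<^esub> te (e y) (e x)) (e z))"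
      using lin_maps_minus[OF module_T module_L \<psi>z te(1) T.smult_closed[OF chi_closed te(2)]]
        lin_maps_smult[OF \<psi>z chi_closed te(2)] mem
      by (simp add: \<psi>_gen)
    also have "TL.te (te (e x) (e y) \<ominus>\<^bsub>T\<^esub> chi x y \<odot>\<^bsub>T\<^esub> te (e y) (e x)) (e z) =
        tensor_map R T L \<gamma> (\<lambda>x. x) w"
      unfolding w TL.tensor_map_elem[OF tensor_pair_T_L gamma_lin_maps lin_maps_id te(1) cl(3)]
      by (simp add: S_gen mem)
    finally show "\<beta> (tensor_map R L L \<beta> (\<lambda>x. x) w) = ?\<psi> (tensor_map R T L \<gamma> (\<lambda>x. x) w)" .
  qed
qed

lemma right_jacobi_slq:
  assumes t: "t \<in> carrier (tensor R L T)"
  shows "\<beta> (tensor_map R L L (\<lambda>x. x) \<beta> t) =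
    \<beta> (tensor_map R L L \<beta> (\<lambda>x. x) (tensor_assoc_inv R L L L (tensor_map R L T (\<lambda>x. x) \<gamma> t)))"
proof -
  note LLp = LL.tensor_pair_axioms
  note map1 = LT.tensor_map_lin_maps[OF LLp lin_maps_id beta_lin_maps]
  note map2 = LT.tensor_map_lin_maps[OF tensor_pair_L_T lin_maps_id gamma_lin_maps]
  note assoc = tensor_assoc_inv_lin_maps[OF module_L module_L module_L]
  note map3 = TL.tensor_map_lin_maps[OF LLp beta_lin_maps lin_maps_id]
  let ?\<psi> = "\<lambda>s. \<beta> (tensor_map R L L \<beta> (\<lambda>x. x) (tensor_assoc_inv R L L L s))"
  have \<psi>: "?\<psi> \<in> lin_maps R (tensor R L T) L"
    by (rule lin_maps_comp[OF lin_maps_comp[OF assoc(1) map3] beta_lin_maps])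
  show ?thesis
  proof (rule determiningD[OF LT.determining_tensor[OF module_L determining_L[OF module_L] determining_T[OF module_L]]
        lin_maps_comp[OF map1 beta_lin_maps] lin_maps_comp[OF map2 \<psi>] _ t])
    fix w assume "w \<in> {LT.te u v | u v. u \<in> e ` sl_basis n \<and>
      v \<in> {te u v | u v. u \<in> e ` sl_basis n \<and> v \<in> e ` sl_basis n}}"
    then obtain x y z where mem: "x \<in> sl_basis n" "y \<in> sl_basis n" "z \<in> sl_basis n"
      and w: "w = LT.te (e x) (te (e y) (e z))" by blast
    note cl = e_closed[OF mem(1)] e_closed[OF mem(2)] e_closed[OF mem(3)]
    have te: "te (e y) (e z) \<in> carrier T" "te (e z) (e y) \<in> carrier T"
      by (simp_all add: LL.tensor_elem_closed cl)
    \<comment> \<open>Here 1 - S acts on the second and third vectors, so e_x is held fixed and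
      linearity in the inner tensor splits the difference.\<close>
    have \<psi>x: "(\<lambda>u. ?\<psi> (LT.te (e x) u)) \<in> lin_maps R T L"
      by (rule lin_maps_comp[OF bilin_maps_right[OF LT.tensor_elem_bilin cl(1)] \<psi>])
    have \<psi>_gen: "?\<psi> (LT.te (e x) (te (e y) (e z))) = \<beta> (te (br x y) (e z))"
      if "y \<in> sl_basis n" "z \<in> sl_basis n" for y z
      using that mem(1) by (simp add: assoc(2) TL.tensor_map_elem[OF LLp beta_lin_maps lin_maps_id]
        LL.tensor_elem_closed e_closed beta_gen)
    have "\<beta> (tensor_map R L L (\<lambda>x. x) \<beta> w) = \<beta> (te (e x) (br y z))"
      unfolding w using te cl mem
      by (simp add: LT.tensor_map_elem[OF LLp lin_maps_id beta_lin_maps] beta_gen)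
    also have "\<dots> = \<beta> (te (br x y) (e z)) \<ominus>\<^bsub>L\<^esub> chi y z \<odot>\<^bsub>L\<^esub> \<beta> (te (br x z) (e y))"
      by (rule right_jacobi_basis[OF mem])
    also have "\<dots> = ?\<psi> (LT.te (e x) (te (e y) (e z) \<ominus>\<^bsub>T\<^esub> chi y z \<odot>\<^bsub>T\<^esub> te (e z) (e y)))"
      using lin_maps_minus[OF module_T module_L \<psi>x te(1) T.smult_closed[OF chi_closed te(2)]]
        lin_maps_smult[OF \<psi>x chi_closed te(2)] mem
      by (simp add: \<psi>_gen)
    also have "LT.te (e x) (te (e y) (e z) \<ominus>\<^bsub>T\<^esub> chi y z \<odot>\<^bsub>T\<^esub> te (e z) (e y)) =
        tensor_map R L T (\<lambda>x. x) \<gamma> w"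
      unfolding w LT.tensor_map_elem[OF tensor_pair_L_T lin_maps_id gamma_lin_maps cl(1) te(1)]
      by (simp add: S_gen mem)
    finally show "\<beta> (tensor_map R L L (\<lambda>x. x) \<beta> w) = ?\<psi> (tensor_map R L T (\<lambda>x. x) \<gamma> w)" .
  qed
qed

end

theorem proposition3:
  fixes R :: "('r, 'm) ring_scheme" and q :: 'r and n :: nat
  assumes "cring R"
    and "q \<in> Units R"
    and "n \<ge> 1"
  shows "balanced_gen_lie_algebra R (slq R n) (slq_bracket R q n)
           (\<lambda>t. t \<ominus>\<^bsub>tensor R (slq R n) (slq R n)\<^esub> slq_S R q n t)"
proof -
  interpret slq_bracket_setting R q n
    using assms(1,2) by (simp add: slq_bracket_setting_def slq_bracket_setting_axioms_def)
  show ?thesis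
    by (intro balanced_gen_lie_algebra.intro balanced_gen_lie_algebra_axioms.intro module_L
      beta_lin_maps gamma_lin_maps antisymmetry left_jacobi_slq right_jacobi_slq)
qed

end
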